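(* Let $\mathcal{P}=(P_0\ltimes P_1,\{\,,\,\})$ be an admissible Poisson algebra with corresponding Poisson triple $([\,,\,]_1,\mathcal{D},\mathcal{K})$. Then there exists a short exact sequence of $R$-modules $$0\longrightarrow\frac{\mathrm{H}^1_{\partial_{\mathcal{D}}}(\Gamma^*_{\mathcal{P}})}{\ker\mathrm{J}}\longrightarrow\mathscr{H}^1_{\mathrm{rest}}(\mathcal{P})\longrightarrow\frac{\mathfrak{M}(\mathcal{P})}{\mathscr{C}(\mathcal{P})+\mathrm{Inn}(P_1,[\,,\,]_1)}\longrightarrow 0.$$
   Context: Let $R$ be a commutative ring with unit, $\mathcal{P}_0=(P_0,\cdot,\{\,,\,\}_0)$ a Poisson $R$-algebra (commutative associative unital $R$-algebra with an $R$-bilinear Lie bracket that is a derivation in each argument), $P_1$ a faithful $P_0$-module, and $P=P_0\ltimes P_1$ the $R$-module $P_0\oplus P_1$ with product $(f\oplus\eta)(g\oplus\xi)=fg\oplus(f\xi+g\eta)$. An admissible Poisson structure on $P$ is a Poisson structure with $\mathrm{pr}_0\{f\oplus\eta,g\oplus\xi\}=\{f,g\}_0$; $\mathcal{P}=(P,\{\,,\,\})$ is then an admissible Poisson algebra. $\Omega^1_{P_0}$ is the module of Kähler differentials of $P_0$ over $R$ with universal derivation $d$, anchor $\varrho_{P_0}(dh)=\{h,\cdot\}_0$ (extended $P_0$-linearly). A contravariant derivative on $P_1$ is an $R$-bilinear map $\mathcal{D}:\Omega^1_{P_0}\times P_1\to P_1$ with $\mathcal{D}_{f\alpha}\eta=f\mathcal{D}_\alpha\eta$,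 $\mathcal{D}_\alpha(f\eta)=f\mathcal{D}_\alpha\eta+\varrho_{P_0}(\alpha)(f)\eta$. Every admissible Poisson algebra has a unique corresponding Poisson triple $([\,,\,]_1,\mathcal{D},\mathcal{K})$, where $[\,,\,]_1$ is a $P_0$-linear Lie bracket on $P_1$, $\mathcal{D}$ a contravariant derivative on $P_1$, and $\mathcal{K}:\Omega^1_{P_0}\times\Omega^1_{P_0}\to P_1$ a $P_0$-bilinear skew-symmetric map, such that $\{f\oplus\eta,g\oplus\xi\}=\{f,g\}_0\oplus(\mathcal{D}_{df}\xi-\mathcal{D}_{dg}\eta+[\eta,\xi]_1+\mathcal{K}(df,dg))$. Write $\mathrm{ad}_\eta=[\eta,\cdot]_1$ and let $\boldsymbol{[}\cdot,\cdot\boldsymbol{]}$ denote the commutator of $R$-linear maps. $\mathrm{Der}(P_0;P_1)$ is the module of $R$-linear $D:P_0\to P_1$ with $D(fg)=fDg+gDf$, and $(d_{\mathcal{D}}\theta)(f,g)=\mathcal{D}_{df}\theta(g)-\mathcal{D}_{dg}\theta(f)-\theta(\{f,g\}_0)$ for $\theta\in\mathrm{Der}(P_0;P_1)$. Complex $(\Gamma^*_{\mathcal{P}},\partial_{\mathcal{D}})$: let $Z_{\mathcal{P}}(P_1)=\{\xi\in P_1\mid[\xi,\cdot]_1=0\}$; $\Gamma^k_R$ is the module of $R$-multilinear skew-symmetric maps $P_0^k\to Z_{\mathcal{P}}(P_1)$ that are derivations in each argument ($\Gamma^0_R=Z_{\mathcal{P}}(P_1)$), and $(\partial_{\mathcal{D}}Q)(f_0,\dots,f_k)=\sum_i(-1)^i\mathcal{D}_{df_i}(Q(\dots,\widehat{f_i},\dots))+\sum_{i<j}(-1)^{i+j}Q(\{f_i,f_j\}_0,f_0,\dots,\widehat{f_i},\dots,\widehat{f_j},\dots,f_k)$.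 $\mathrm{H}^1_{\partial_{\mathcal{D}}}(\Gamma^*_{\mathcal{P}})$ is its first cohomology. An $R$-linear $X:P\to P$ is written as a matrix with entries $X_{ij}:P_j\to P_i$, $X(f\oplus\eta)=(X_{00}f+X_{01}\eta)\oplus(X_{10}f+X_{11}\eta)$. $\mathrm{Poiss}(\mathcal{P})$ is the set of derivations of the algebra $P$ that are also derivations of $\{\,,\,\}$; $\mathrm{Ham}(\mathcal{P})=\{\{\pi,\cdot\}\mid\pi\in P\}$; $\mathscr{H}^1(\mathcal{P})=\mathrm{Poiss}(\mathcal{P})/\mathrm{Ham}(\mathcal{P})$ (similarly for $\mathcal{P}_0$). $\mathrm{Poiss}_1(\mathcal{P})$ is the set of $X\in\mathrm{Poiss}(\mathcal{P})$ with $X_{01}=0$; it contains $\mathrm{Ham}(\mathcal{P})$, and $\mathscr{H}^1_{\mathrm{rest}}(\mathcal{P})=\mathrm{Poiss}_1(\mathcal{P})/\mathrm{Ham}(\mathcal{P})$. The map $\mathrm{J}:\mathrm{H}^1_{\partial_{\mathcal{D}}}(\Gamma^*_{\mathcal{P}})\to\mathscr{H}^1(\mathcal{P})$ is $\mathrm{J}[c]=\left[\begin{pmatrix}0&0\\c&0\end{pmatrix}\right]$. A generalized $\ell$-derivation of $P_1$ ($\ell\in\mathrm{Der}(P_0)$) is an $R$-linear $\mathscr{L}:P_1\to P_1$ with $\mathscr{L}(f\eta)=f\mathscr{L}\eta+\ell(f)\eta$. $\mathfrak{M}(\mathcal{P})$ is the set of generalized $\ell$-derivations $\mathscr{L}$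 of $P_1$ with $\ell\in\mathrm{Poiss}(\mathcal{P}_0)$, $\mathscr{L}[\eta,\xi]_1=[\mathscr{L}\eta,\xi]_1+[\eta,\mathscr{L}\xi]_1$, and for which there is $\theta\in\mathrm{Der}(P_0;P_1)$ such that for all $f,g\in P_0$: $\boldsymbol{[}\mathcal{D}_{df},\mathscr{L}\boldsymbol{]}+\mathcal{D}_{d\ell(f)}=\mathrm{ad}_{\theta(f)}$ and $\mathscr{L}(\mathcal{K}(df,dg))-\mathcal{K}(d\ell(f),dg)-\mathcal{K}(df,d\ell(g))=-(d_{\mathcal{D}}\theta)(f,g)$. Its submodules are $\mathscr{C}(\mathcal{P})=\{\mathcal{D}_{df}\mid f\in P_0\}$ and $\mathrm{Inn}(P_1,[\,,\,]_1)=\{\mathrm{ad}_\eta\mid\eta\in P_1\}$. *)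

theory Defs
  imports "HOL-Algebra.Module" "HOL-Algebra.AbelCoset"
begin

text \<open>Linear maps, derivations and all other maps forming a module are taken to be extensional
  (undefined outside their domain), so that equality of maps is equality on the domain.
  The fields \<open>mult\<close> and \<open>one\<close> of a record that is only used as a module are irrelevant.\<close>

definition fun_module :: "'i set \<Rightarrow> ('r, 'm) module \<Rightarrow> ('i \<Rightarrow> 'm) set \<Rightarrow> ('r, 'i \<Rightarrow> 'm) module" where
  "fun_module S M F = \<lparr>carrier = F, mult = (\<lambda>_ _. undefined), one = undefined,
     zero = (\<lambda>x\<in>S. \<zero>\<^bsub>M\<^esub>), add = (\<lambda>f g. \<lambda>x\<in>S. f x \<oplus>\<^bsub>M\<^esub> g x),
     smult = (\<lambda>r f. \<lambda>x\<in>S. r \<odot>\<^bsub>M\<^esub> f x)\<rparr>"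

definition quot_module :: "('r, 'm) module \<Rightarrow> 'm set \<Rightarrow> ('r, 'm set) module" where
  "quot_module M N = \<lparr>carrier = a_rcosets\<^bsub>M\<^esub> N, mult = (\<lambda>_ _. undefined), one = undefined,
     zero = N, add = (\<lambda>X Y. X <+>\<^bsub>M\<^esub> Y),
     smult = (\<lambda>r X. \<Union>x\<in>X. N +>\<^bsub>M\<^esub> (r \<odot>\<^bsub>M\<^esub> x))\<rparr>"

definition self_module :: "('r, 'a) module \<Rightarrow> ('a, 'a) module" where
  "self_module A = \<lparr>carrier = carrier A, mult = mult A, one = one A,
     zero = zero A, add = add A, smult = mult A\<rparr>"

text \<open>The \<open>R\<close>-module underlying a module over an \<open>R\<close>-algebra \<open>A\<close>: \<open>r\<close> acts as \<open>r \<cdot> 1\<close>.\<close>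

definition restrict_scalars :: "('r, 'a) module \<Rightarrow> ('a, 'm) module \<Rightarrow> ('r, 'm) module" where
  "restrict_scalars A M = \<lparr>carrier = carrier M, mult = mult M, one = one M,
     zero = zero M, add = add M, smult = (\<lambda>r x. (r \<odot>\<^bsub>A\<^esub> \<one>\<^bsub>A\<^esub>) \<odot>\<^bsub>M\<^esub> x)\<rparr>"

definition module_homs ::
    "('r, 'x) ring_scheme \<Rightarrow> ('r, 'm) module \<Rightarrow> ('r, 'n) module \<Rightarrow> ('m \<Rightarrow> 'n) set" where
  "module_homs R M N = {h \<in> carrier M \<rightarrow>\<^sub>E carrier N.
     (\<forall>x\<in>carrier M. \<forall>y\<in>carrier M. h (x \<oplus>\<^bsub>M\<^esub> y) = h x \<oplus>\<^bsub>N\<^esub> h y) \<and>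
     (\<forall>r\<in>carrier R. \<forall>x\<in>carrier M. h (r \<odot>\<^bsub>M\<^esub> x) = r \<odot>\<^bsub>N\<^esub> h x)}"

definition bilinear_map :: "('r, 'x) ring_scheme \<Rightarrow> ('r, 'm) module \<Rightarrow> ('r, 'n) module \<Rightarrow>
    ('r, 'q) module \<Rightarrow> ('m \<Rightarrow> 'n \<Rightarrow> 'q) \<Rightarrow> bool" where
  "bilinear_map R M N Q B \<longleftrightarrow>
     (\<forall>x\<in>carrier M. (\<lambda>y\<in>carrier N. B x y) \<in> module_homs R N Q) \<and>
     (\<forall>y\<in>carrier N. (\<lambda>x\<in>carrier M. B x y) \<in> module_homs R M Q)"

definition faithful_module :: "('r, 'a) module \<Rightarrow> ('a, 'm) module \<Rightarrow> bool" where
  "faithful_module A M \<longleftrightarrow> module A M \<and>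
     (\<forall>f\<in>carrier A. (\<forall>\<eta>\<in>carrier M. f \<odot>\<^bsub>M\<^esub> \<eta> = \<zero>\<^bsub>M\<^esub>) \<longrightarrow> f = \<zero>\<^bsub>A\<^esub>)"

text \<open>Exactness of \<open>0 \<rightarrow> A \<rightarrow> B \<rightarrow> C \<rightarrow> 0\<close>, including that the three objects are \<open>R\<close>-modules.\<close>

definition short_exact_sequence :: "('r, 'x) ring_scheme \<Rightarrow> ('r, 'm) module \<Rightarrow> ('r, 'n) module \<Rightarrow>
    ('r, 'q) module \<Rightarrow> ('m \<Rightarrow> 'n) \<Rightarrow> ('n \<Rightarrow> 'q) \<Rightarrow> bool" where
  "short_exact_sequence R A B C \<phi> \<psi> \<longleftrightarrow>
     module R A \<and> module R B \<and> module R C \<and>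
     \<phi> \<in> module_homs R A B \<and> \<psi> \<in> module_homs R B C \<and>
     inj_on \<phi> (carrier A) \<and> \<phi> ` carrier A = a_kernel B C \<psi> \<and> \<psi> ` carrier B = carrier C"

definition derivations ::
    "('r, 'x) ring_scheme \<Rightarrow> ('r, 'a) module \<Rightarrow> ('a, 'm) module \<Rightarrow> ('a \<Rightarrow> 'm) set" where
  "derivations R A M = {D \<in> module_homs R A (restrict_scalars A M).
     \<forall>f\<in>carrier A. \<forall>g\<in>carrier A. D (f \<otimes>\<^bsub>A\<^esub> g) = f \<odot>\<^bsub>M\<^esub> D g \<oplus>\<^bsub>M\<^esub> g \<odot>\<^bsub>M\<^esub> D f}"

text \<open>Kaehler differentials: the free \<open>A\<close>-module on symbols \<open>\<delta> f\<close>, \<open>f \<in> A\<close>, modulo the submodule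
  generated by the relations making \<open>\<delta>\<close> an \<open>R\<close>-linear derivation.\<close>

definition free_on_carrier :: "('r, 'a) module \<Rightarrow> ('a, 'a \<Rightarrow> 'a) module" where
  "free_on_carrier A = fun_module (carrier A) (self_module A)
     {c \<in> carrier A \<rightarrow>\<^sub>E carrier A. finite {x \<in> carrier A. c x \<noteq> \<zero>\<^bsub>A\<^esub>}}"

definition basis_elem :: "('r, 'a) module \<Rightarrow> 'a \<Rightarrow> 'a \<Rightarrow> 'a" where
  "basis_elem A f = (\<lambda>x\<in>carrier A. if x = f then \<one>\<^bsub>A\<^esub> else \<zero>\<^bsub>A\<^esub>)"

definition kaehler_relations :: "('r, 'x) ring_scheme \<Rightarrow> ('r, 'a) module \<Rightarrow> ('a \<Rightarrow> 'a) set" where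
  "kaehler_relations R A = (let F = free_on_carrier A; \<delta> = basis_elem A in
     {\<delta> (f \<oplus>\<^bsub>A\<^esub> g) \<ominus>\<^bsub>F\<^esub> (\<delta> f \<oplus>\<^bsub>F\<^esub> \<delta> g) | f g. f \<in> carrier A \<and> g \<in> carrier A} \<union>
     {\<delta> (r \<odot>\<^bsub>A\<^esub> f) \<ominus>\<^bsub>F\<^esub> (r \<odot>\<^bsub>A\<^esub> \<one>\<^bsub>A\<^esub>) \<odot>\<^bsub>F\<^esub> \<delta> f | r f. r \<in> carrier R \<and> f \<in> carrier A} \<union>
     {\<delta> (f \<otimes>\<^bsub>A\<^esub> g) \<ominus>\<^bsub>F\<^esub> (f \<odot>\<^bsub>F\<^esub> \<delta> g \<oplus>\<^bsub>F\<^esub> g \<odot>\<^bsub>F\<^esub> \<delta> f) | f g. f \<in> carrier A \<and> g \<in> carrier A})"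

definition kaehler_submodule :: "('r, 'x) ring_scheme \<Rightarrow> ('r, 'a) module \<Rightarrow> ('a \<Rightarrow> 'a) set" where
  "kaehler_submodule R A =
     \<Inter>{N. submodule N A (free_on_carrier A) \<and> kaehler_relations R A \<subseteq> N}"

definition kaehler :: "('r, 'x) ring_scheme \<Rightarrow> ('r, 'a) module \<Rightarrow> ('a, ('a \<Rightarrow> 'a) set) module" where
  "kaehler R A = quot_module (free_on_carrier A) (kaehler_submodule R A)"

definition kaehler_d :: "('r, 'x) ring_scheme \<Rightarrow> ('r, 'a) module \<Rightarrow> 'a \<Rightarrow> ('a \<Rightarrow> 'a) set" where
  "kaehler_d R A f = kaehler_submodule R A +>\<^bsub>free_on_carrier A\<^esub> basis_elem A f"

definition lie_bracket :: "('r, 'x) ring_scheme \<Rightarrow> ('r, 'm) module \<Rightarrow> ('m \<Rightarrow> 'm \<Rightarrow> 'm) \<Rightarrow> bool" where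
  "lie_bracket R L br \<longleftrightarrow> bilinear_map R L L L br \<and>
     (\<forall>x\<in>carrier L. br x x = \<zero>\<^bsub>L\<^esub>) \<and>
     (\<forall>x\<in>carrier L. \<forall>y\<in>carrier L. \<forall>z\<in>carrier L.
        br x (br y z) \<oplus>\<^bsub>L\<^esub> br y (br z x) \<oplus>\<^bsub>L\<^esub> br z (br x y) = \<zero>\<^bsub>L\<^esub>)"

definition poisson_algebra :: "('r, 'x) ring_scheme \<Rightarrow> ('r, 'a) module \<Rightarrow> ('a \<Rightarrow> 'a \<Rightarrow> 'a) \<Rightarrow> bool" where
  "poisson_algebra R A br \<longleftrightarrow> algebra R A \<and> lie_bracket R A br \<and>
     (\<forall>f\<in>carrier A. (\<lambda>g\<in>carrier A. br f g) \<in> derivations R A (self_module A)) \<and>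
     (\<forall>g\<in>carrier A. (\<lambda>f\<in>carrier A. br f g) \<in> derivations R A (self_module A))"

definition Poiss :: "('r, 'x) ring_scheme \<Rightarrow> ('r, 'a) module \<Rightarrow> ('a \<Rightarrow> 'a \<Rightarrow> 'a) \<Rightarrow> ('a \<Rightarrow> 'a) set" where
  "Poiss R A br = {X \<in> derivations R A (self_module A).
     \<forall>x\<in>carrier A. \<forall>y\<in>carrier A. X (br x y) = br (X x) y \<oplus>\<^bsub>A\<^esub> br x (X y)}"

definition Ham :: "('r, 'a) module \<Rightarrow> ('a \<Rightarrow> 'a \<Rightarrow> 'a) \<Rightarrow> ('a \<Rightarrow> 'a) set" where
  "Ham A br = (\<lambda>\<pi>. \<lambda>x\<in>carrier A. br \<pi> x) ` carrier A"

definition poisson_H1 ::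
    "('r, 'x) ring_scheme \<Rightarrow> ('r, 'a) module \<Rightarrow> ('a \<Rightarrow> 'a \<Rightarrow> 'a) \<Rightarrow> ('r, ('a \<Rightarrow> 'a) set) module" where
  "poisson_H1 R A br = quot_module (fun_module (carrier A) A (Poiss R A br)) (Ham A br)"

definition semidirect :: "('r, 'a) module \<Rightarrow> ('a, 'm) module \<Rightarrow> ('r, 'a \<times> 'm) module" where
  "semidirect P0 P1 = \<lparr>carrier = carrier P0 \<times> carrier P1,
     mult = (\<lambda>(f, \<eta>) (g, \<xi>). (f \<otimes>\<^bsub>P0\<^esub> g, f \<odot>\<^bsub>P1\<^esub> \<xi> \<oplus>\<^bsub>P1\<^esub> g \<odot>\<^bsub>P1\<^esub> \<eta>)),
     one = (\<one>\<^bsub>P0\<^esub>, \<zero>\<^bsub>P1\<^esub>),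
     zero = (\<zero>\<^bsub>P0\<^esub>, \<zero>\<^bsub>P1\<^esub>),
     add = (\<lambda>(f, \<eta>) (g, \<xi>). (f \<oplus>\<^bsub>P0\<^esub> g, \<eta> \<oplus>\<^bsub>P1\<^esub> \<xi>)),
     smult = (\<lambda>r (f, \<eta>). (r \<odot>\<^bsub>P0\<^esub> f, r \<odot>\<^bsub>restrict_scalars P0 P1\<^esub> \<eta>))\<rparr>"

definition admissible_poisson_algebra :: "('r, 'x) ring_scheme \<Rightarrow> ('r, 'a) module \<Rightarrow> ('a, 'm) module \<Rightarrow>
    ('a \<Rightarrow> 'a \<Rightarrow> 'a) \<Rightarrow> ('a \<times> 'm \<Rightarrow> 'a \<times> 'm \<Rightarrow> 'a \<times> 'm) \<Rightarrow> bool" where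
  "admissible_poisson_algebra R P0 P1 br0 br \<longleftrightarrow>
     poisson_algebra R P0 br0 \<and> faithful_module P0 P1 \<and>
     poisson_algebra R (semidirect P0 P1) br \<and>
     (\<forall>f\<in>carrier P0. \<forall>g\<in>carrier P0. \<forall>\<eta>\<in>carrier P1. \<forall>\<xi>\<in>carrier P1.
        fst (br (f, \<eta>) (g, \<xi>)) = br0 f g)"

definition anchor :: "('r, 'x) ring_scheme \<Rightarrow> ('r, 'a) module \<Rightarrow> ('a \<Rightarrow> 'a \<Rightarrow> 'a) \<Rightarrow>
    ('a \<Rightarrow> 'a) set \<Rightarrow> 'a \<Rightarrow> 'a" where
  "anchor R A br = (THE \<rho>.
     \<rho> \<in> module_homs A (kaehler R A)
          (fun_module (carrier A) (self_module A) (derivations R A (self_module A))) \<and>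
     (\<forall>h\<in>carrier A. \<rho> (kaehler_d R A h) = (\<lambda>g\<in>carrier A. br h g)))"

definition contravariant_derivative :: "('r, 'x) ring_scheme \<Rightarrow> ('r, 'a) module \<Rightarrow> ('a, 'm) module \<Rightarrow>
    ('a \<Rightarrow> 'a \<Rightarrow> 'a) \<Rightarrow> (('a \<Rightarrow> 'a) set \<Rightarrow> 'm \<Rightarrow> 'm) \<Rightarrow> bool" where
  "contravariant_derivative R P0 P1 br0 D \<longleftrightarrow>
     bilinear_map R (restrict_scalars P0 (kaehler R P0)) (restrict_scalars P0 P1)
       (restrict_scalars P0 P1) D \<and>
     (\<forall>f\<in>carrier P0. \<forall>\<alpha>\<in>carrier (kaehler R P0). \<forall>\<eta>\<in>carrier P1.
        D (f \<odot>\<^bsub>kaehler R P0\<^esub> \<alpha>) \<eta> = f \<odot>\<^bsub>P1\<^esub> D \<alpha> \<eta> \<and>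
        D \<alpha> (f \<odot>\<^bsub>P1\<^esub> \<eta>) = f \<odot>\<^bsub>P1\<^esub> D \<alpha> \<eta> \<oplus>\<^bsub>P1\<^esub> anchor R P0 br0 \<alpha> f \<odot>\<^bsub>P1\<^esub> \<eta>)"

definition corresponding_poisson_triple ::
    "('r, 'x) ring_scheme \<Rightarrow> ('r, 'a) module \<Rightarrow> ('a, 'm) module \<Rightarrow>
     ('a \<Rightarrow> 'a \<Rightarrow> 'a) \<Rightarrow> ('a \<times> 'm \<Rightarrow> 'a \<times> 'm \<Rightarrow> 'a \<times> 'm) \<Rightarrow>
     ('m \<Rightarrow> 'm \<Rightarrow> 'm) \<Rightarrow> (('a \<Rightarrow> 'a) set \<Rightarrow> 'm \<Rightarrow> 'm) \<Rightarrow>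
     (('a \<Rightarrow> 'a) set \<Rightarrow> ('a \<Rightarrow> 'a) set \<Rightarrow> 'm) \<Rightarrow> bool" where
  "corresponding_poisson_triple R P0 P1 br0 br br1 D K \<longleftrightarrow>
     lie_bracket P0 P1 br1 \<and>
     contravariant_derivative R P0 P1 br0 D \<and>
     bilinear_map P0 (kaehler R P0) (kaehler R P0) P1 K \<and>
     (\<forall>\<alpha>\<in>carrier (kaehler R P0). \<forall>\<beta>\<in>carrier (kaehler R P0). K \<beta> \<alpha> = \<ominus>\<^bsub>P1\<^esub> K \<alpha> \<beta>) \<and>
     (\<forall>f\<in>carrier P0. \<forall>g\<in>carrier P0. \<forall>\<eta>\<in>carrier P1. \<forall>\<xi>\<in>carrier P1.
        br (f, \<eta>) (g, \<xi>) =
          (br0 f g,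
           D (kaehler_d R P0 f) \<xi> \<ominus>\<^bsub>P1\<^esub> D (kaehler_d R P0 g) \<eta> \<oplus>\<^bsub>P1\<^esub> br1 \<eta> \<xi>
             \<oplus>\<^bsub>P1\<^esub> K (kaehler_d R P0 f) (kaehler_d R P0 g)))"

definition lie_center :: "('a, 'm) module \<Rightarrow> ('m \<Rightarrow> 'm \<Rightarrow> 'm) \<Rightarrow> 'm set" where
  "lie_center P1 br1 = {\<xi> \<in> carrier P1. \<forall>\<eta>\<in>carrier P1. br1 \<xi> \<eta> = \<zero>\<^bsub>P1\<^esub>}"

text \<open>\<open>k\<close>-tuples \<open>(f\<^sub>0, \<dots>, f\<^sub>k\<^sub>-\<^sub>1)\<close> are lists of length \<open>k\<close>; a 0-cochain, which is an element of the
  center, is represented as a function on \<open>{[]}\<close>.\<close>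

definition tuples :: "('r, 'a) module \<Rightarrow> nat \<Rightarrow> 'a list set" where
  "tuples A k = {fs. set fs \<subseteq> carrier A \<and> length fs = k}"

definition cochains :: "('r, 'x) ring_scheme \<Rightarrow> ('r, 'a) module \<Rightarrow> ('a, 'm) module \<Rightarrow>
    ('m \<Rightarrow> 'm \<Rightarrow> 'm) \<Rightarrow> nat \<Rightarrow> ('a list \<Rightarrow> 'm) set" where
  "cochains R P0 P1 br1 k = {Q \<in> tuples P0 k \<rightarrow>\<^sub>E lie_center P1 br1.
     (\<forall>fs\<in>tuples P0 k. \<forall>i<k. (\<lambda>f\<in>carrier P0. Q (fs[i := f])) \<in> derivations R P0 P1) \<and>
     (\<forall>fs\<in>tuples P0 k. \<forall>i<k. \<forall>j<k. i \<noteq> j \<longrightarrow>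
        Q (fs[i := fs ! j, j := fs ! i]) = \<ominus>\<^bsub>P1\<^esub> Q fs)}"

definition cochain_module :: "('r, 'x) ring_scheme \<Rightarrow> ('r, 'a) module \<Rightarrow> ('a, 'm) module \<Rightarrow>
    ('m \<Rightarrow> 'm \<Rightarrow> 'm) \<Rightarrow> nat \<Rightarrow> ('r, 'a list \<Rightarrow> 'm) module" where
  "cochain_module R P0 P1 br1 k =
     fun_module (tuples P0 k) (restrict_scalars P0 P1) (cochains R P0 P1 br1 k)"

definition alt_sign :: "('a, 'm) module \<Rightarrow> nat \<Rightarrow> 'm \<Rightarrow> 'm" where
  "alt_sign M n x = (if even n then x else \<ominus>\<^bsub>M\<^esub> x)"

text \<open>\<open>nths fs (- I)\<close> is the tuple \<open>fs\<close> with the entries at the positions in \<open>I\<close> omitted.\<close>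

definition cochain_differential :: "('r, 'x) ring_scheme \<Rightarrow> ('r, 'a) module \<Rightarrow> ('a, 'm) module \<Rightarrow>
    ('a \<Rightarrow> 'a \<Rightarrow> 'a) \<Rightarrow> (('a \<Rightarrow> 'a) set \<Rightarrow> 'm \<Rightarrow> 'm) \<Rightarrow> nat \<Rightarrow>
    ('a list \<Rightarrow> 'm) \<Rightarrow> 'a list \<Rightarrow> 'm" where
  "cochain_differential R P0 P1 br0 D k Q = (\<lambda>fs\<in>tuples P0 (Suc k).
     (\<Oplus>\<^bsub>P1\<^esub>i\<in>{..k}. alt_sign P1 i (D (kaehler_d R P0 (fs ! i)) (Q (nths fs (- {i}))))) \<oplus>\<^bsub>P1\<^esub>
     (\<Oplus>\<^bsub>P1\<^esub>ij\<in>{(i, j). i < j \<and> j \<le> k}.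
        case ij of (i, j) \<Rightarrow>
          alt_sign P1 (i + j) (Q (br0 (fs ! i) (fs ! j) # nths fs (- {i, j})))))"

definition cocycles :: "('r, 'x) ring_scheme \<Rightarrow> ('r, 'a) module \<Rightarrow> ('a, 'm) module \<Rightarrow>
    ('a \<Rightarrow> 'a \<Rightarrow> 'a) \<Rightarrow> ('m \<Rightarrow> 'm \<Rightarrow> 'm) \<Rightarrow> (('a \<Rightarrow> 'a) set \<Rightarrow> 'm \<Rightarrow> 'm) \<Rightarrow> nat \<Rightarrow>
    ('a list \<Rightarrow> 'm) set" where
  "cocycles R P0 P1 br0 br1 D k = {Q \<in> cochains R P0 P1 br1 k.
     cochain_differential R P0 P1 br0 D k Q = \<zero>\<^bsub>cochain_module R P0 P1 br1 (Suc k)\<^esub>}"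

definition coboundaries :: "('r, 'x) ring_scheme \<Rightarrow> ('r, 'a) module \<Rightarrow> ('a, 'm) module \<Rightarrow>
    ('a \<Rightarrow> 'a \<Rightarrow> 'a) \<Rightarrow> ('m \<Rightarrow> 'm \<Rightarrow> 'm) \<Rightarrow> (('a \<Rightarrow> 'a) set \<Rightarrow> 'm \<Rightarrow> 'm) \<Rightarrow> nat \<Rightarrow>
    ('a list \<Rightarrow> 'm) set" where
  "coboundaries R P0 P1 br0 br1 D k = (case k of
     0 \<Rightarrow> {\<zero>\<^bsub>cochain_module R P0 P1 br1 0\<^esub>}
   | Suc j \<Rightarrow> cochain_differential R P0 P1 br0 D j ` cochains R P0 P1 br1 j)"

definition cohomology :: "('r, 'x) ring_scheme \<Rightarrow> ('r, 'a) module \<Rightarrow> ('a, 'm) module \<Rightarrow>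
    ('a \<Rightarrow> 'a \<Rightarrow> 'a) \<Rightarrow> ('m \<Rightarrow> 'm \<Rightarrow> 'm) \<Rightarrow> (('a \<Rightarrow> 'a) set \<Rightarrow> 'm \<Rightarrow> 'm) \<Rightarrow> nat \<Rightarrow>
    ('r, ('a list \<Rightarrow> 'm) set) module" where
  "cohomology R P0 P1 br0 br1 D k =
     quot_module ((cochain_module R P0 P1 br1 k)\<lparr>carrier := cocycles R P0 P1 br0 br1 D k\<rparr>)
       (coboundaries R P0 P1 br0 br1 D k)"

definition block_map :: "('r, 'a) module \<Rightarrow> ('a, 'm) module \<Rightarrow>
    ('a \<Rightarrow> 'a) \<Rightarrow> ('m \<Rightarrow> 'a) \<Rightarrow> ('a \<Rightarrow> 'm) \<Rightarrow> ('m \<Rightarrow> 'm) \<Rightarrow> 'a \<times> 'm \<Rightarrow> 'a \<times> 'm" where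
  "block_map P0 P1 X00 X01 X10 X11 = (\<lambda>(f, \<eta>)\<in>carrier (semidirect P0 P1).
     (X00 f \<oplus>\<^bsub>P0\<^esub> X01 \<eta>, X10 f \<oplus>\<^bsub>P1\<^esub> X11 \<eta>))"

definition Poiss1 :: "('r, 'x) ring_scheme \<Rightarrow> ('r, 'a) module \<Rightarrow> ('a, 'm) module \<Rightarrow>
    ('a \<times> 'm \<Rightarrow> 'a \<times> 'm \<Rightarrow> 'a \<times> 'm) \<Rightarrow> ('a \<times> 'm \<Rightarrow> 'a \<times> 'm) set" where
  "Poiss1 R P0 P1 br = {X \<in> Poiss R (semidirect P0 P1) br.
     \<forall>\<eta>\<in>carrier P1. fst (X (\<zero>\<^bsub>P0\<^esub>, \<eta>)) = \<zero>\<^bsub>P0\<^esub>}"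

definition poisson_H1_rest :: "('r, 'x) ring_scheme \<Rightarrow> ('r, 'a) module \<Rightarrow> ('a, 'm) module \<Rightarrow>
    ('a \<times> 'm \<Rightarrow> 'a \<times> 'm \<Rightarrow> 'a \<times> 'm) \<Rightarrow> ('r, ('a \<times> 'm \<Rightarrow> 'a \<times> 'm) set) module" where
  "poisson_H1_rest R P0 P1 br =
     quot_module (fun_module (carrier (semidirect P0 P1)) (semidirect P0 P1) (Poiss1 R P0 P1 br))
       (Ham (semidirect P0 P1) br)"

text \<open>The value of \<open>J\<close> on a class is the union over its representatives \<open>c\<close> of the classes of the
  induced maps; all of these coincide.\<close>

definition J_map :: "('r, 'x) ring_scheme \<Rightarrow> ('r, 'a) module \<Rightarrow> ('a, 'm) module \<Rightarrow>
    ('a \<times> 'm \<Rightarrow> 'a \<times> 'm \<Rightarrow> 'a \<times> 'm) \<Rightarrow> ('a list \<Rightarrow> 'm) set \<Rightarrow> ('a \<times> 'm \<Rightarrow> 'a \<times> 'm) set" where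
  "J_map R P0 P1 br C = (let P = semidirect P0 P1 in
     \<Union>c\<in>C. Ham P br +>\<^bsub>fun_module (carrier P) P (Poiss R P br)\<^esub>
       block_map P0 P1 (\<lambda>f. \<zero>\<^bsub>P0\<^esub>) (\<lambda>\<eta>. \<zero>\<^bsub>P0\<^esub>) (\<lambda>f. c [f]) (\<lambda>\<eta>. \<zero>\<^bsub>P1\<^esub>))"

definition generalized_derivation :: "('r, 'x) ring_scheme \<Rightarrow> ('r, 'a) module \<Rightarrow> ('a, 'm) module \<Rightarrow>
    ('a \<Rightarrow> 'a) \<Rightarrow> ('m \<Rightarrow> 'm) \<Rightarrow> bool" where
  "generalized_derivation R P0 P1 l L \<longleftrightarrow>
     L \<in> module_homs R (restrict_scalars P0 P1) (restrict_scalars P0 P1) \<and>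
     (\<forall>f\<in>carrier P0. \<forall>\<eta>\<in>carrier P1.
        L (f \<odot>\<^bsub>P1\<^esub> \<eta>) = f \<odot>\<^bsub>P1\<^esub> L \<eta> \<oplus>\<^bsub>P1\<^esub> l f \<odot>\<^bsub>P1\<^esub> \<eta>)"

definition d_contravariant :: "('r, 'x) ring_scheme \<Rightarrow> ('r, 'a) module \<Rightarrow> ('a, 'm) module \<Rightarrow>
    ('a \<Rightarrow> 'a \<Rightarrow> 'a) \<Rightarrow> (('a \<Rightarrow> 'a) set \<Rightarrow> 'm \<Rightarrow> 'm) \<Rightarrow> ('a \<Rightarrow> 'm) \<Rightarrow> 'a \<Rightarrow> 'a \<Rightarrow> 'm" where
  "d_contravariant R P0 P1 br0 D \<theta> f g =
     D (kaehler_d R P0 f) (\<theta> g) \<ominus>\<^bsub>P1\<^esub> D (kaehler_d R P0 g) (\<theta> f) \<ominus>\<^bsub>P1\<^esub> \<theta> (br0 f g)"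

definition frakM :: "('r, 'x) ring_scheme \<Rightarrow> ('r, 'a) module \<Rightarrow> ('a, 'm) module \<Rightarrow>
    ('a \<Rightarrow> 'a \<Rightarrow> 'a) \<Rightarrow> ('m \<Rightarrow> 'm \<Rightarrow> 'm) \<Rightarrow> (('a \<Rightarrow> 'a) set \<Rightarrow> 'm \<Rightarrow> 'm) \<Rightarrow>
    (('a \<Rightarrow> 'a) set \<Rightarrow> ('a \<Rightarrow> 'a) set \<Rightarrow> 'm) \<Rightarrow> ('m \<Rightarrow> 'm) set" where
  "frakM R P0 P1 br0 br1 D K = {L. \<exists>l\<in>Poiss R P0 br0.
     generalized_derivation R P0 P1 l L \<and>
     (\<forall>\<eta>\<in>carrier P1. \<forall>\<xi>\<in>carrier P1. L (br1 \<eta> \<xi>) = br1 (L \<eta>) \<xi> \<oplus>\<^bsub>P1\<^esub> br1 \<eta> (L \<xi>)) \<and>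
     (\<exists>\<theta>\<in>derivations R P0 P1. \<forall>f\<in>carrier P0. \<forall>g\<in>carrier P0.
        (\<forall>\<eta>\<in>carrier P1.
           (D (kaehler_d R P0 f) (L \<eta>) \<ominus>\<^bsub>P1\<^esub> L (D (kaehler_d R P0 f) \<eta>))
             \<oplus>\<^bsub>P1\<^esub> D (kaehler_d R P0 (l f)) \<eta> = br1 (\<theta> f) \<eta>) \<and>
        L (K (kaehler_d R P0 f) (kaehler_d R P0 g))
          \<ominus>\<^bsub>P1\<^esub> K (kaehler_d R P0 (l f)) (kaehler_d R P0 g)
          \<ominus>\<^bsub>P1\<^esub> K (kaehler_d R P0 f) (kaehler_d R P0 (l g))
          = \<ominus>\<^bsub>P1\<^esub> d_contravariant R P0 P1 br0 D \<theta> f g)}"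

definition frakM_module :: "('r, 'x) ring_scheme \<Rightarrow> ('r, 'a) module \<Rightarrow> ('a, 'm) module \<Rightarrow>
    ('a \<Rightarrow> 'a \<Rightarrow> 'a) \<Rightarrow> ('m \<Rightarrow> 'm \<Rightarrow> 'm) \<Rightarrow> (('a \<Rightarrow> 'a) set \<Rightarrow> 'm \<Rightarrow> 'm) \<Rightarrow>
    (('a \<Rightarrow> 'a) set \<Rightarrow> ('a \<Rightarrow> 'a) set \<Rightarrow> 'm) \<Rightarrow> ('r, 'm \<Rightarrow> 'm) module" where
  "frakM_module R P0 P1 br0 br1 D K =
     fun_module (carrier P1) (restrict_scalars P0 P1) (frakM R P0 P1 br0 br1 D K)"

definition scrC :: "('r, 'x) ring_scheme \<Rightarrow> ('r, 'a) module \<Rightarrow> ('a, 'm) module \<Rightarrow>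
    (('a \<Rightarrow> 'a) set \<Rightarrow> 'm \<Rightarrow> 'm) \<Rightarrow> ('m \<Rightarrow> 'm) set" where
  "scrC R P0 P1 D = (\<lambda>f. \<lambda>\<eta>\<in>carrier P1. D (kaehler_d R P0 f) \<eta>) ` carrier P0"

definition Inn :: "('a, 'm) module \<Rightarrow> ('m \<Rightarrow> 'm \<Rightarrow> 'm) \<Rightarrow> ('m \<Rightarrow> 'm) set" where
  "Inn P1 br1 = (\<lambda>\<eta>. \<lambda>\<xi>\<in>carrier P1. br1 \<eta> \<xi>) ` carrier P1"

end

theory Submission
  imports Defs
begin

text \<open>Division by the kernel of \<open>J\<close> is forced: a cocycle can give a Hamiltonian
  map without being a coboundary. The map \<open>br (h, \<zeta>)\<close> has zero diagonal entries
  as soon as \<open>Dd h \<eta> \<oplus> br1 \<zeta> \<eta>\<close> vanishes for all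
  \<open>\<eta>\<close>, and its remaining entry sends \<open>f\<close> to \<open>Kd h f\<close>
  minus \<open>Dd f \<zeta>\<close>. If \<open>br0\<close>, \<open>br1\<close> and \<open>D\<close>
  are zero and \<open>K\<close> is not, all coboundaries vanish while some \<open>Kd h\<close> do
  not.

  The argument lives on numerators: linear maps from cocycles to \<open>Poiss1\<close> to
  \<open>frakM\<close>, exact up to Hamiltonian derivations. A general lemma on modules passes to
  the quotients, because the submodule divided out on the right is exactly the image of
  \<open>Ham\<close>.

  \<open>Poiss1\<close> is the only one of the three whose closure properties are checked directly.
  \<open>frakM\<close> is a module as an image of \<open>Poiss1\<close>, and cocycles are one as a
  preimage under \<open>c \<mapsto> (0, 0; c, 0)\<close>. In particular, that coboundaries are
  cocycles follows from Hamiltonian maps being Poisson derivations, and the square of the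
  differential is never computed.\<close>

text \<open>
  A Poisson derivation \<open>X\<close> of \<open>P\<close> with \<open>X\<^sub>0\<^sub>1 = 0\<close> is determined by the entries \<open>X\<^sub>0\<^sub>0\<close>,
  \<open>X\<^sub>1\<^sub>0\<close>, \<open>X\<^sub>1\<^sub>1\<close>, and evaluating the derivation property on pairs from \<open>P\<^sub>0\<close> and \<open>P\<^sub>1\<close>
  yields exactly the conditions defining \<open>\<MM>(\<P>)\<close> for \<open>\<L> = X\<^sub>1\<^sub>1\<close>, \<open>\<ell> = X\<^sub>0\<^sub>0\<close> and
  \<open>\<theta> = - X\<^sub>1\<^sub>0\<close>. Hence \<open>X \<mapsto> X\<^sub>1\<^sub>1\<close> maps onto \<open>\<MM>(\<P>)\<close> and sends the Hamiltonian
  derivations onto \<open>\<C>(\<P>) + Inn\<close>. If \<open>X\<^sub>1\<^sub>1 = 0\<close>, faithfulness gives \<open>X\<^sub>0\<^sub>0 = 0\<close>, and the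
  remaining conditions say that \<open>X\<^sub>1\<^sub>0\<close> is a 1-cocycle with values in the center.
\<close>

section \<open>Quotients of modules\<close>

lemma quot_module_simps [simp]:
  "carrier (quot_module M N) = a_rcosets\<^bsub>M\<^esub> N"
  "zero (quot_module M N) = N"
  "add (quot_module M N) = (\<lambda>X Y. X <+>\<^bsub>M\<^esub> Y)"
  "smult (quot_module M N) = (\<lambda>r X. \<Union>x\<in>X. N +>\<^bsub>M\<^esub> (r \<odot>\<^bsub>M\<^esub> x))"
  by (simp_all add: quot_module_def)

lemma a_rcosets_eq_image: "a_rcosets\<^bsub>M\<^esub> N = (\<lambda>x. N +>\<^bsub>M\<^esub> x) ` carrier M"
  by (auto simp: A_RCOSETS_def')

lemma module_homsD:
  assumes "h \<in> module_homs R M N"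
  shows "x \<in> carrier M \<Longrightarrow> h x \<in> carrier N"
    and "x \<in> carrier M \<Longrightarrow> y \<in> carrier M \<Longrightarrow> h (x \<oplus>\<^bsub>M\<^esub> y) = h x \<oplus>\<^bsub>N\<^esub> h y"
    and "r \<in> carrier R \<Longrightarrow> x \<in> carrier M \<Longrightarrow> h (r \<odot>\<^bsub>M\<^esub> x) = r \<odot>\<^bsub>N\<^esub> h x"
    and "h \<in> extensional (carrier M)"
  using assms by (auto simp: module_homs_def PiE_iff)

lemma module_homsI:
  assumes "\<And>x. x \<in> carrier M \<Longrightarrow> h x \<in> carrier N"
    and "\<And>x y. x \<in> carrier M \<Longrightarrow> y \<in> carrier M \<Longrightarrow> h (x \<oplus>\<^bsub>M\<^esub> y) = h x \<oplus>\<^bsub>N\<^esub> h y"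
    and "\<And>r x. r \<in> carrier R \<Longrightarrow> x \<in> carrier M \<Longrightarrow> h (r \<odot>\<^bsub>M\<^esub> x) = r \<odot>\<^bsub>N\<^esub> h x"
    and "h \<in> extensional (carrier M)"
  shows "h \<in> module_homs R M N"
  using assms by (auto simp: module_homs_def PiE_iff)

lemma module_homs_zero:
  assumes "abelian_group M" "abelian_group N" "h \<in> module_homs R M N"
  shows "h \<zero>\<^bsub>M\<^esub> = \<zero>\<^bsub>N\<^esub>"
proof -
  interpret M: abelian_group M by fact
  interpret N: abelian_group N by fact
  have "h \<zero>\<^bsub>M\<^esub> \<oplus>\<^bsub>N\<^esub> h \<zero>\<^bsub>M\<^esub> = h \<zero>\<^bsub>M\<^esub>"
    using module_homsD(2)[OF assms(3), of "\<zero>\<^bsub>M\<^esub>" "\<zero>\<^bsub>M\<^esub>"] by simp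
  then show ?thesis
    using module_homsD(1)[OF assms(3)] by (metis M.zero_closed N.add.r_cancel_one')
qed

lemma module_homs_neg:
  assumes "abelian_group M" "abelian_group N" "h \<in> module_homs R M N" "x \<in> carrier M"
  shows "h (\<ominus>\<^bsub>M\<^esub> x) = \<ominus>\<^bsub>N\<^esub> h x"
proof -
  interpret M: abelian_group M by fact
  interpret N: abelian_group N by fact
  have "h (\<ominus>\<^bsub>M\<^esub> x) \<oplus>\<^bsub>N\<^esub> h x = \<zero>\<^bsub>N\<^esub>"
    using module_homsD(2)[OF assms(3), of "\<ominus>\<^bsub>M\<^esub> x" x] assms(4)
    by (simp add: M.l_neg module_homs_zero[OF assms(1-3)])
  then show ?thesis
    using module_homsD(1)[OF assms(3)] assms(4) by (metis M.a_inv_closed N.minus_equality)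
qed

lemma module_homs_compose:
  assumes "h \<in> module_homs R L M" "k \<in> module_homs R M N"
    and "abelian_group L" "\<And>r x. r \<in> carrier R \<Longrightarrow> x \<in> carrier L \<Longrightarrow> r \<odot>\<^bsub>L\<^esub> x \<in> carrier L"
  shows "compose (carrier L) k h \<in> module_homs R L N"
proof (rule module_homsI)
  interpret L: abelian_group L by fact
  fix x y r assume x: "x \<in> carrier L"
  then show "compose (carrier L) k h x \<in> carrier N"
    using module_homsD(1)[OF assms(1)] module_homsD(1)[OF assms(2)] by (simp add: compose_eq)
  show "compose (carrier L) k h (x \<oplus>\<^bsub>L\<^esub> y) = compose (carrier L) k h x \<oplus>\<^bsub>N\<^esub> compose (carrier L) k h y"
    if "y \<in> carrier L"
    using that x module_homsD(1,2)[OF assms(1)] module_homsD(2)[OF assms(2)] by (simp add: compose_eq)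
  show "compose (carrier L) k h (r \<odot>\<^bsub>L\<^esub> x) = r \<odot>\<^bsub>N\<^esub> compose (carrier L) k h x"
    if "r \<in> carrier R"
    using that x assms(4) module_homsD(1,3)[OF assms(1)] module_homsD(3)[OF assms(2)] by (simp add: compose_eq)
qed (simp add: compose_extensional)

lemma a_kernel_iff: "x \<in> a_kernel M N h \<longleftrightarrow> x \<in> carrier M \<and> h x = \<zero>\<^bsub>N\<^esub>"
  by (simp add: a_kernel_def')

text \<open>The target enters a kernel only through its zero, so two different targets may be
  compared. This later exchanges \<open>Poiss/Ham\<close> for \<open>Poiss1/Ham\<close>.\<close>

lemma a_kernel_cong:
  assumes "\<zero>\<^bsub>N\<^esub> = \<zero>\<^bsub>N'\<^esub>" "\<And>x. x \<in> carrier M \<Longrightarrow> h x = h' x"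
  shows "a_kernel M N h = a_kernel M N' h'"
  using assms by (auto simp: a_kernel_iff)

lemma submodule_a_kernel:
  assumes "module R M" "module R N" "h \<in> module_homs R M N"
  shows "submodule (a_kernel M N h) R M"
proof -
  interpret M: module R M by fact
  interpret N: module R N by fact
  note h = module_homsD[OF assms(3)] module_homs_zero[OF M.abelian_group_axioms N.abelian_group_axioms assms(3)]
    module_homs_neg[OF M.abelian_group_axioms N.abelian_group_axioms assms(3)]
  show ?thesis
    by (rule M.submoduleI) (auto simp: a_kernel_iff h)
qed

lemma submodule_image:
  assumes "module R M" "module R N" "h \<in> module_homs R M N" "submodule H R M"
  shows "submodule (h ` H) R N"
proof -
  interpret M: module R M by fact
  interpret N: module R N by fact
  note h = module_homsD[OF assms(3)] module_homs_zero[OF M.abelian_group_axioms N.abelian_group_axioms assms(3)]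
    module_homs_neg[OF M.abelian_group_axioms N.abelian_group_axioms assms(3)]
  interpret H: submodule H R M by fact
  have H: "\<And>x. x \<in> H \<Longrightarrow> x \<in> carrier M" "\<zero>\<^bsub>M\<^esub> \<in> H" using H.subset H.one_closed by auto
  note HE = M.submoduleE[OF assms(4)]
  show ?thesis
  proof (rule N.submoduleI)
    show "h ` H \<subseteq> carrier N" using h H by auto
    show "\<zero>\<^bsub>N\<^esub> \<in> h ` H" using h H by force
    show "\<ominus>\<^bsub>N\<^esub> a \<in> h ` H" if "a \<in> h ` H" for a
      using that H HE(3) by (auto simp flip: h(6))
    show "a \<oplus>\<^bsub>N\<^esub> b \<in> h ` H" if "a \<in> h ` H" "b \<in> h ` H" for a b
      using that H HE(5) by (auto simp flip: h(2))
    show "a \<odot>\<^bsub>N\<^esub> b \<in> h ` H" if "a \<in> carrier R" "b \<in> h ` H" for a b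
      using that H HE(4) by (auto simp flip: h(3))
  qed
qed

text \<open>When \<open>h\<close> vanishes on \<open>N\<close>, the image of a coset is a singleton,
  and \<open>the_elem\<close> extracts its value without choosing a representative.\<close>

definition induced_map :: "('r, 'm) module \<Rightarrow> 'm set \<Rightarrow> ('m \<Rightarrow> 'n) \<Rightarrow> 'm set \<Rightarrow> 'n" where
  "induced_map M N h = (\<lambda>X\<in>a_rcosets\<^bsub>M\<^esub> N. the_elem (h ` X))"

locale quotient_module = M: module R M + submodule N R M
  for R :: "('r, 'x) ring_scheme" (structure) and M :: "('r, 'm) module" (structure) and N
begin

sublocale abelian_subgroup N M
  by (intro abelian_subgroupI3 additive_subgroup.intro subgroup_axioms M.abelian_group_axioms)

lemma coset_eq_iff:
  assumes "x \<in> carrier M" "y \<in> carrier M"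
  shows "N +>\<^bsub>M\<^esub> x = N +>\<^bsub>M\<^esub> y \<longleftrightarrow> x \<ominus>\<^bsub>M\<^esub> y \<in> N"
  using assms a_rcos_module[of y x] a_rcos_self[of x] a_repr_independence'[of x y]
  by (metis M.minus_eq)

lemma coset_eq_self_iff:
  assumes "x \<in> carrier M"
  shows "N +>\<^bsub>M\<^esub> x = N \<longleftrightarrow> x \<in> N"
  using assms by (metis M.a_coset_join1 M.a_coset_join2 a_subgroup)

lemma mem_coset_iff: "y \<in> N +>\<^bsub>M\<^esub> x \<longleftrightarrow> (\<exists>n\<in>N. y = n \<oplus>\<^bsub>M\<^esub> x)"
  by (auto simp: a_r_coset_def')

text \<open>Scalar multiplication in \<open>quot_module\<close> is a union over all representatives.
  It collapses to one coset because representatives differ by elements of \<open>N\<close>, and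
  \<open>N\<close> absorbs scalars.\<close>

lemma coset_smult:
  assumes "r \<in> carrier R" "x \<in> carrier M"
  shows "r \<odot>\<^bsub>quot_module M N\<^esub> (N +>\<^bsub>M\<^esub> x) = N +>\<^bsub>M\<^esub> (r \<odot>\<^bsub>M\<^esub> x)"
proof -
  have "N +>\<^bsub>M\<^esub> (r \<odot>\<^bsub>M\<^esub> y) = N +>\<^bsub>M\<^esub> (r \<odot>\<^bsub>M\<^esub> x)" if "y \<in> N +>\<^bsub>M\<^esub> x" for y
  proof -
    obtain n where n: "n \<in> N" "y = n \<oplus>\<^bsub>M\<^esub> x" using \<open>y \<in> _\<close> by (auto simp: mem_coset_iff)
    then have "r \<odot>\<^bsub>M\<^esub> y = r \<odot>\<^bsub>M\<^esub> n \<oplus>\<^bsub>M\<^esub> r \<odot>\<^bsub>M\<^esub> x"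
      using assms by (simp add: M.smult_r_distr)
    then have "r \<odot>\<^bsub>M\<^esub> y \<in> N +>\<^bsub>M\<^esub> (r \<odot>\<^bsub>M\<^esub> x)"
      using n assms by (auto simp: mem_coset_iff)
    then show ?thesis
      using a_repr_independence'[of "r \<odot>\<^bsub>M\<^esub> y" "r \<odot>\<^bsub>M\<^esub> x"] assms by simp
  qed
  then have "(\<Union>y\<in>N +>\<^bsub>M\<^esub> x. N +>\<^bsub>M\<^esub> (r \<odot>\<^bsub>M\<^esub> y)) = (\<Union>y\<in>N +>\<^bsub>M\<^esub> x. N +>\<^bsub>M\<^esub> (r \<odot>\<^bsub>M\<^esub> x))"
    by (rule SUP_cong[OF refl])
  also have "\<dots> = N +>\<^bsub>M\<^esub> (r \<odot>\<^bsub>M\<^esub> x)"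
    \<comment> \<open>A union of a constant family equals the constant only over a nonempty index
      set; the coset contains \<open>x\<close>.\<close>
    using a_rcos_self[OF assms(2)] by (simp only: UN_constant) (metis empty_iff)
  finally show ?thesis by simp
qed

lemma coset_add:
  assumes "x \<in> carrier M" "y \<in> carrier M"
  shows "(N +>\<^bsub>M\<^esub> x) \<oplus>\<^bsub>quot_module M N\<^esub> (N +>\<^bsub>M\<^esub> y) = N +>\<^bsub>M\<^esub> (x \<oplus>\<^bsub>M\<^esub> y)"
  using assms by (simp add: a_rcos_sum)

text \<open>Each axiom is pulled back to representatives by \<open>coset_add\<close> and
  \<open>coset_smult\<close>. The equations unfolding the operations are withheld from the
  simplifier so that these two rules can fire.\<close>

lemma module_quot_module: "module R (quot_module M N)"
proof (rule moduleI)
  have zero: "N = N +>\<^bsub>M\<^esub> \<zero>\<^bsub>M\<^esub>" by (rule sym) (simp add: coset_eq_self_iff)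
  show "abelian_group (quot_module M N)"
  proof (rule abelian_groupI)
    show "\<exists>Y\<in>carrier (quot_module M N). Y \<oplus>\<^bsub>quot_module M N\<^esub> X = \<zero>\<^bsub>quot_module M N\<^esub>"
      if X: "X \<in> carrier (quot_module M N)" for X
    proof -
      obtain x where x: "x \<in> carrier M" "X = N +>\<^bsub>M\<^esub> x"
        using X by (auto simp: a_rcosets_eq_image)
      then have "(N +>\<^bsub>M\<^esub> (\<ominus>\<^bsub>M\<^esub> x)) \<oplus>\<^bsub>quot_module M N\<^esub> X = N"
        by (simp add: coset_add M.l_neg flip: zero del: quot_module_simps(3))
      then show ?thesis using x by (auto simp: a_rcosets_eq_image)
    qed
    show "\<zero>\<^bsub>quot_module M N\<^esub> \<oplus>\<^bsub>quot_module M N\<^esub> X = X" if X: "X \<in> carrier (quot_module M N)" for X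
    proof -
      obtain x where x: "x \<in> carrier M" "X = N +>\<^bsub>M\<^esub> x"
        using X by (auto simp: a_rcosets_eq_image)
      then show ?thesis
        using coset_add[of "\<zero>\<^bsub>M\<^esub>" x] by (simp flip: zero del: quot_module_simps(3))
    qed
    show "\<zero>\<^bsub>quot_module M N\<^esub> \<in> carrier (quot_module M N)"
      using zero by (auto simp: a_rcosets_eq_image)
  qed (auto simp: a_rcosets_eq_image coset_add M.a_ac simp del: quot_module_simps(3))
qed (auto simp: a_rcosets_eq_image coset_smult coset_add M.smult_l_distr M.smult_r_distr
    M.smult_assoc1 M.R.is_cring simp del: quot_module_simps(3,4))

lemma projection_hom: "(\<lambda>x\<in>carrier M. N +>\<^bsub>M\<^esub> x) \<in> module_homs R M (quot_module M N)"
  by (rule module_homsI)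
    (simp_all add: coset_smult coset_add a_rcosets_eq_image del: quot_module_simps(3,4))

lemma induced_map_coset:
  assumes "x \<in> carrier M" "abelian_group L" "h \<in> module_homs R M L" "\<And>n. n \<in> N \<Longrightarrow> h n = \<zero>\<^bsub>L\<^esub>"
  shows "induced_map M N h (N +>\<^bsub>M\<^esub> x) = h x"
proof -
  interpret L: abelian_group L by fact
  have "h ` (N +>\<^bsub>M\<^esub> x) = {h x}"
    using a_rcos_self[OF assms(1)] assms(1,4) module_homsD(1,2)[OF assms(3)] by (auto simp: mem_coset_iff)
  then show ?thesis using assms(1) by (simp add: induced_map_def a_rcosets_eq_image)
qed

lemma induced_map_hom:
  assumes "abelian_group L" "h \<in> module_homs R M L" "\<And>n. n \<in> N \<Longrightarrow> h n = \<zero>\<^bsub>L\<^esub>"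
  shows "induced_map M N h \<in> module_homs R (quot_module M N) L"
proof (rule module_homsI)
  show "induced_map M N h \<in> extensional (carrier (quot_module M N))"
    by (simp add: induced_map_def)
qed (auto simp: a_rcosets_eq_image induced_map_coset[OF _ assms] coset_smult coset_add
    module_homsD[OF assms(2)] simp del: quot_module_simps(3,4))

lemma induced_map_image:
  assumes "abelian_group L" "h \<in> module_homs R M L" "\<And>n. n \<in> N \<Longrightarrow> h n = \<zero>\<^bsub>L\<^esub>"
  shows "induced_map M N h ` carrier (quot_module M N) = h ` carrier M"
  by (auto simp: a_rcosets_eq_image induced_map_coset[OF _ assms] image_image)

end

text \<open>The injective half of the first isomorphism theorem; it yields injectivity of the left
  arrow of the sequence.\<close>

lemma induced_map_inj:
  assumes "module R M" "module R L" "h \<in> module_homs R M L"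
  shows "inj_on (induced_map M (a_kernel M L h) h) (carrier (quot_module M (a_kernel M L h)))"
proof -
  interpret L: module R L by fact
  interpret quotient_module R M "a_kernel M L h"
    using assms by (intro quotient_module.intro submodule_a_kernel)
  note h = module_homsD[OF assms(3)]
    module_homs_neg[OF M.abelian_group_axioms L.abelian_group_axioms assms(3)]
  have "h n = \<zero>\<^bsub>L\<^esub>" if "n \<in> a_kernel M L h" for n using that by (simp add: a_kernel_iff)
  note ind = induced_map_coset[OF _ L.abelian_group_axioms assms(3) this]
  show ?thesis
  proof (rule inj_onI)
    fix X Y assume "X \<in> carrier (quot_module M (a_kernel M L h))" "Y \<in> carrier (quot_module M (a_kernel M L h))"
      and eq: "induced_map M (a_kernel M L h) h X = induced_map M (a_kernel M L h) h Y"
    then obtain x y where xy: "x \<in> carrier M" "y \<in> carrier M"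
      and X: "X = a_kernel M L h +>\<^bsub>M\<^esub> x" and Y: "Y = a_kernel M L h +>\<^bsub>M\<^esub> y"
      by (auto simp: a_rcosets_eq_image)
    have "h x = h y" using eq xy by (simp add: X Y ind)
    then have "x \<ominus>\<^bsub>M\<^esub> y \<in> a_kernel M L h"
      using xy h(1) by (simp add: a_kernel_iff M.minus_eq h L.r_neg)
    then show "X = Y" using xy by (simp add: X Y coset_eq_iff)
  qed
qed

text \<open>Only the zero of \<open>Q\<close> matters: \<open>J\<close> takes values in \<open>Poiss/Ham\<close>, which contains
  \<open>B/N = Poiss1/Ham\<close> and has the same zero.\<close>

lemma short_exact_sequence_quotients:
  assumes Z: "module R Z" and B: "module R B" and C: "module R C"
    and j: "j \<in> module_homs R Z B" and p: "p \<in> module_homs R B C" and surj: "p ` carrier B = carrier C"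
    and T: "submodule T R Z" and N: "submodule N R B" and jT: "j ` T \<subseteq> N"
    and exact: "\<And>x. x \<in> carrier B \<Longrightarrow> p x \<in> p ` N \<longleftrightarrow> (\<exists>z\<in>carrier Z. \<exists>n\<in>N. x = n \<oplus>\<^bsub>B\<^esub> j z)"
    and J: "\<And>z. z \<in> carrier Z \<Longrightarrow> J (T +>\<^bsub>Z\<^esub> z) = N +>\<^bsub>B\<^esub> j z" and Q: "\<zero>\<^bsub>Q\<^esub> = N"
  shows "\<exists>\<phi> \<psi>. short_exact_sequence R (quot_module (quot_module Z T) (a_kernel (quot_module Z T) Q J))
    (quot_module B N) (quot_module C (p ` N)) \<phi> \<psi>"
proof -
  interpret Z: quotient_module R Z T using Z T by (rule quotient_module.intro)
  interpret B: quotient_module R B N using B N by (rule quotient_module.intro)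
  interpret C: quotient_module R C "p ` N"
    using C submodule_image[OF B C p N] by (rule quotient_module.intro)
  let ?B = "quot_module B N" and ?Z = "quot_module Z T" and ?C = "quot_module C (p ` N)"
  interpret QB: module R ?B by (rule B.module_quot_module)
  interpret QZ: module R ?Z by (rule Z.module_quot_module)
  interpret QC: module R ?C by (rule C.module_quot_module)
  note jD = module_homsD[OF j] and pD = module_homsD[OF p]
  let ?j = "compose (carrier Z) (\<lambda>x\<in>carrier B. N +>\<^bsub>B\<^esub> x) j"
  have j': "?j \<in> module_homs R Z ?B"
    by (rule module_homs_compose[OF j B.projection_hom Z.M.abelian_group_axioms]) auto
  have jT': "?j t = \<zero>\<^bsub>?B\<^esub>" if "t \<in> T" for t
    using that jT Z.a_subset B.coset_eq_self_iff[of "j t"] jD(1) by (auto simp: compose_eq)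
  \<comment> \<open>\<open>J'\<close> is the honest linear map on \<open>Z/T\<close> with values in
    \<open>B/N\<close>; \<open>J\<close> is known only through its values on cosets.\<close>
  define J' where "J' = induced_map Z T ?j"
  have J'_hom: "J' \<in> module_homs R ?Z ?B"
    unfolding J'_def by (rule Z.induced_map_hom[OF QB.abelian_group_axioms j' jT'])
  have J'_coset: "J' (T +>\<^bsub>Z\<^esub> z) = N +>\<^bsub>B\<^esub> j z" if "z \<in> carrier Z" for z
    using that Z.induced_map_coset[OF that QB.abelian_group_axioms j' jT'] jD(1)
    by (simp add: J'_def compose_eq)
  have ker: "a_kernel ?Z Q J = a_kernel ?Z ?B J'"
    by (rule a_kernel_cong) (auto simp: Q a_rcosets_eq_image J J'_coset)
  let ?k = "a_kernel ?Z ?B J'"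
  interpret K: quotient_module R ?Z ?k
    using QZ.module_axioms submodule_a_kernel[OF QZ.module_axioms QB.module_axioms J'_hom]
    by (rule quotient_module.intro)
  define \<phi> where "\<phi> = induced_map ?Z ?k J'"
  have k0: "J' n = \<zero>\<^bsub>?B\<^esub>" if "n \<in> ?k" for n using that by (simp add: a_kernel_iff)
  have \<phi>_image: "\<phi> ` carrier (quot_module ?Z ?k) = (\<lambda>z. N +>\<^bsub>B\<^esub> j z) ` carrier Z"
    using K.induced_map_image[OF QB.abelian_group_axioms J'_hom k0]
    by (simp only: \<phi>_def) (simp add: a_rcosets_eq_image image_image J'_coset cong: image_cong)
  let ?p = "compose (carrier B) (\<lambda>x\<in>carrier C. p ` N +>\<^bsub>C\<^esub> x) p"
  have p': "?p \<in> module_homs R B ?C"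
    by (rule module_homs_compose[OF p C.projection_hom B.M.abelian_group_axioms]) auto
  have pN: "?p n = \<zero>\<^bsub>?C\<^esub>" if "n \<in> N" for n
    using that B.a_subset C.coset_eq_self_iff[of "p n"] pD(1) by (auto simp: compose_eq)
  define \<psi> where "\<psi> = induced_map B N ?p"
  have \<psi>_hom: "\<psi> \<in> module_homs R ?B ?C"
    unfolding \<psi>_def by (rule B.induced_map_hom[OF QC.abelian_group_axioms p' pN])
  have \<psi>_coset: "\<psi> (N +>\<^bsub>B\<^esub> x) = p ` N +>\<^bsub>C\<^esub> p x" if "x \<in> carrier B" for x
    using that B.induced_map_coset[OF that QC.abelian_group_axioms p' pN] pD(1)
    by (simp add: \<psi>_def compose_eq)
  have "\<psi> ` carrier ?B = carrier ?C"
    by (simp add: a_rcosets_eq_image image_image \<psi>_coset surj[symmetric])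
  moreover have "\<phi> ` carrier (quot_module ?Z ?k) = a_kernel ?B ?C \<psi>"
  proof -
    have coset_iff: "(N +>\<^bsub>B\<^esub> x \<in> (\<lambda>z. N +>\<^bsub>B\<^esub> j z) ` carrier Z) \<longleftrightarrow> \<psi> (N +>\<^bsub>B\<^esub> x) = \<zero>\<^bsub>?C\<^esub>"
      if x: "x \<in> carrier B" for x
    proof -
      have eq: "N +>\<^bsub>B\<^esub> x = N +>\<^bsub>B\<^esub> j z \<longleftrightarrow> (\<exists>n\<in>N. x = n \<oplus>\<^bsub>B\<^esub> j z)" if "z \<in> carrier Z" for z
        using B.a_rcos_self[OF x] B.a_repr_independence'[of x "j z"] jD(1)[OF that] x
        by (metis B.mem_coset_iff)
      have "p x \<in> p ` N \<longleftrightarrow> (\<exists>z\<in>carrier Z. N +>\<^bsub>B\<^esub> x = N +>\<^bsub>B\<^esub> j z)"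
        unfolding exact[OF x] by (rule bex_cong[OF refl eq[symmetric]])
      then have "(N +>\<^bsub>B\<^esub> x \<in> (\<lambda>z. N +>\<^bsub>B\<^esub> j z) ` carrier Z) \<longleftrightarrow> p x \<in> p ` N"
        by (simp only: image_iff)
      also have "\<dots> \<longleftrightarrow> \<psi> (N +>\<^bsub>B\<^esub> x) = \<zero>\<^bsub>?C\<^esub>"
        using x pD(1)[OF x] by (simp add: \<psi>_coset C.coset_eq_self_iff)
      finally show ?thesis .
    qed
    have iff: "X \<in> (\<lambda>z. N +>\<^bsub>B\<^esub> j z) ` carrier Z \<longleftrightarrow> \<psi> X = \<zero>\<^bsub>?C\<^esub>" if X: "X \<in> carrier ?B" for X
    proof -
      obtain x where "x \<in> carrier B" "X = N +>\<^bsub>B\<^esub> x"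
        using X by (auto simp: a_rcosets_eq_image)
      then show ?thesis using coset_iff[of x] by (simp only:)
    qed
    have sub: "(\<lambda>z. N +>\<^bsub>B\<^esub> j z) ` carrier Z \<subseteq> carrier ?B"
      unfolding quot_module_simps(1) a_rcosets_eq_image using jD(1) by blast
    show ?thesis
      unfolding \<phi>_image
    proof (intro subset_antisym subsetI)
      fix X assume "X \<in> (\<lambda>z. N +>\<^bsub>B\<^esub> j z) ` carrier Z"
      then show "X \<in> a_kernel ?B ?C \<psi>"
        unfolding a_kernel_iff using sub iff[of X] by blast
    next
      fix X assume "X \<in> a_kernel ?B ?C \<psi>"
      then show "X \<in> (\<lambda>z. N +>\<^bsub>B\<^esub> j z) ` carrier Z"
        unfolding a_kernel_iff using iff[of X] by blast
    qed
  qed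
  moreover have "\<phi> \<in> module_homs R (quot_module ?Z ?k) ?B"
    unfolding \<phi>_def by (rule K.induced_map_hom[OF QB.abelian_group_axioms J'_hom k0])
  moreover have "inj_on \<phi> (carrier (quot_module ?Z ?k))"
    unfolding \<phi>_def by (rule induced_map_inj[OF QZ.module_axioms QB.module_axioms J'_hom])
  ultimately have "short_exact_sequence R (quot_module ?Z ?k) ?B ?C \<phi> \<psi>"
    using \<psi>_hom by (simp only: short_exact_sequence_def K.module_quot_module
        QB.module_axioms QC.module_axioms simp_thms)
  then show ?thesis unfolding ker by blast
qed

section \<open>Modules of maps and derivations\<close>

lemma fun_module_simps [simp]:
  "carrier (fun_module S M F) = F"
  "zero (fun_module S M F) = (\<lambda>x\<in>S. \<zero>\<^bsub>M\<^esub>)"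
  "add (fun_module S M F) = (\<lambda>f g. \<lambda>x\<in>S. f x \<oplus>\<^bsub>M\<^esub> g x)"
  "smult (fun_module S M F) = (\<lambda>r f. \<lambda>x\<in>S. r \<odot>\<^bsub>M\<^esub> f x)"
  by (simp_all add: fun_module_def)

text \<open>Pointwise operations inherit all identities from \<open>M\<close>; what remains is
  closure of \<open>F\<close>.\<close>

lemma module_fun_module:
  assumes "module R M" "F \<subseteq> S \<rightarrow>\<^sub>E carrier M" "(\<lambda>x\<in>S. \<zero>\<^bsub>M\<^esub>) \<in> F"
    and add: "\<And>f g. f \<in> F \<Longrightarrow> g \<in> F \<Longrightarrow> (\<lambda>x\<in>S. f x \<oplus>\<^bsub>M\<^esub> g x) \<in> F"
    and smult: "\<And>r f. r \<in> carrier R \<Longrightarrow> f \<in> F \<Longrightarrow> (\<lambda>x\<in>S. r \<odot>\<^bsub>M\<^esub> f x) \<in> F"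
  shows "module R (fun_module S M F)"
proof -
  interpret M: module R M by fact
  have F: "f x \<in> carrier M" if "f \<in> F" "x \<in> S" for f x using that assms(2) by auto
  have ext: "(\<lambda>x\<in>S. f x) = f" if "f \<in> F" for f
    using that assms(2) by (meson PiE_restrict subsetD)
  show ?thesis
  proof (rule moduleI)
    show "abelian_group (fun_module S M F)"
    proof (rule abelian_groupI)
      fix f assume f: "f \<in> carrier (fun_module S M F)"
      \<comment> \<open>Additive inverses are obtained as multiples by minus one, so closure under
        scalars provides them.\<close>
      then have "(\<lambda>x\<in>S. (\<ominus>\<^bsub>R\<^esub> \<one>\<^bsub>R\<^esub>) \<odot>\<^bsub>M\<^esub> f x) \<in> F" using smult by simp
      moreover have "(\<lambda>x\<in>S. (\<lambda>x\<in>S. (\<ominus>\<^bsub>R\<^esub> \<one>\<^bsub>R\<^esub>) \<odot>\<^bsub>M\<^esub> f x) x \<oplus>\<^bsub>M\<^esub> f x) = (\<lambda>x\<in>S. \<zero>\<^bsub>M\<^esub>)"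
        using f F by (auto simp: M.smult_l_minus M.M.l_neg intro!: restrict_ext)
      ultimately show "\<exists>g\<in>carrier (fun_module S M F). g \<oplus>\<^bsub>fun_module S M F\<^esub> f = \<zero>\<^bsub>fun_module S M F\<^esub>"
        by (intro bexI) simp_all
    next
      fix f assume f: "f \<in> carrier (fun_module S M F)"
      have "(\<lambda>x\<in>S. (\<lambda>x\<in>S. \<zero>\<^bsub>M\<^esub>) x \<oplus>\<^bsub>M\<^esub> f x) = (\<lambda>x\<in>S. f x)"
        using f F by (auto intro!: restrict_ext)
      then show "\<zero>\<^bsub>fun_module S M F\<^esub> \<oplus>\<^bsub>fun_module S M F\<^esub> f = f"
        using f ext by simp
    qed (auto simp: F M.M.a_ac assms intro!: restrict_ext)
    fix f assume f: "f \<in> carrier (fun_module S M F)"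
    have "(\<lambda>x\<in>S. \<one>\<^bsub>R\<^esub> \<odot>\<^bsub>M\<^esub> f x) = (\<lambda>x\<in>S. f x)"
      using f F by (auto intro!: restrict_ext)
    then show "\<one>\<^bsub>R\<^esub> \<odot>\<^bsub>fun_module S M F\<^esub> f = f" using f ext by simp
  qed (auto simp: F assms M.smult_l_distr M.smult_r_distr M.smult_assoc1 M.R.is_cring intro!: restrict_ext)
qed

lemma (in module) submoduleI':
  assumes subset: "H \<subseteq> carrier M" and zero: "\<zero>\<^bsub>M\<^esub> \<in> H"
    and add: "\<And>a b. a \<in> H \<Longrightarrow> b \<in> H \<Longrightarrow> a \<oplus>\<^bsub>M\<^esub> b \<in> H"
    and smult: "\<And>a x. a \<in> carrier R \<Longrightarrow> x \<in> H \<Longrightarrow> a \<odot>\<^bsub>M\<^esub> x \<in> H"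
  shows "submodule H R M"
proof (rule submoduleI)
  show "\<ominus>\<^bsub>M\<^esub> a \<in> H" if "a \<in> H" for a
    using smult[of "\<ominus>\<^bsub>R\<^esub> \<one>\<^bsub>R\<^esub>" a] that subset by (auto simp: smult_l_minus subset_iff)
qed (use assms in auto)

lemma restrict_scalars_simps [simp]:
  "carrier (restrict_scalars A M) = carrier M"
  "zero (restrict_scalars A M) = \<zero>\<^bsub>M\<^esub>"
  "add (restrict_scalars A M) = add M"
  "smult (restrict_scalars A M) = (\<lambda>r x. (r \<odot>\<^bsub>A\<^esub> \<one>\<^bsub>A\<^esub>) \<odot>\<^bsub>M\<^esub> x)"
  by (simp_all add: restrict_scalars_def)

lemma self_module_simps [simp]:
  "carrier (self_module A) = carrier A"
  "zero (self_module A) = \<zero>\<^bsub>A\<^esub>"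
  "add (self_module A) = add A"
  "smult (self_module A) = mult A"
  by (simp_all add: self_module_def)

text \<open>Scalars act through \<open>r \<mapsto> r \<odot> \<one>\<close>. Associativity of the
  new action is the multiplicativity of this map, which holds because \<open>A\<close> is an
  algebra.\<close>

lemma module_restrict_scalars:
  assumes "algebra R A" "module A M"
  shows "module R (restrict_scalars A M)"
proof -
  interpret A: algebra R A by fact
  interpret M: module A M by fact
  show ?thesis
  proof (rule moduleI)
    show "abelian_group (restrict_scalars A M)"
    proof (rule abelian_groupI)
      show "\<exists>y\<in>carrier (restrict_scalars A M). y \<oplus>\<^bsub>restrict_scalars A M\<^esub> x = \<zero>\<^bsub>restrict_scalars A M\<^esub>"
        if "x \<in> carrier (restrict_scalars A M)" for x
        using that by (intro bexI[of _ "\<ominus>\<^bsub>M\<^esub> x"]) (auto simp: M.M.l_neg)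
    qed (auto simp: M.M.a_ac)
    fix a b x assume "a \<in> carrier R" "b \<in> carrier R" "x \<in> carrier (restrict_scalars A M)"
    then show "(a \<otimes>\<^bsub>R\<^esub> b) \<odot>\<^bsub>restrict_scalars A M\<^esub> x =
        a \<odot>\<^bsub>restrict_scalars A M\<^esub> (b \<odot>\<^bsub>restrict_scalars A M\<^esub> x)"
      by (simp add: A.smult_assoc1 A.smult_assoc2 flip: M.smult_assoc1)
  qed (auto simp: A.smult_l_distr M.smult_l_distr M.smult_r_distr A.R.is_cring)
qed

lemma (in algebra) smult_one_mult:
  "r \<in> carrier R \<Longrightarrow> x \<in> carrier M \<Longrightarrow> (r \<odot>\<^bsub>M\<^esub> \<one>\<^bsub>M\<^esub>) \<otimes>\<^bsub>M\<^esub> x = r \<odot>\<^bsub>M\<^esub> x"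
  by (simp add: smult_assoc2)

lemma (in algebra) smult_assoc2':
  "r \<in> carrier R \<Longrightarrow> x \<in> carrier M \<Longrightarrow> y \<in> carrier M \<Longrightarrow> x \<otimes>\<^bsub>M\<^esub> (r \<odot>\<^bsub>M\<^esub> y) = r \<odot>\<^bsub>M\<^esub> (x \<otimes>\<^bsub>M\<^esub> y)"
  using smult_assoc2[of r y x] by (metis m_comm smult_closed)

lemma derivations_iff:
  "X \<in> derivations R A M \<longleftrightarrow> X \<in> carrier A \<rightarrow>\<^sub>E carrier M \<and>
    (\<forall>x\<in>carrier A. \<forall>y\<in>carrier A. X (x \<oplus>\<^bsub>A\<^esub> y) = X x \<oplus>\<^bsub>M\<^esub> X y) \<and>
    (\<forall>r\<in>carrier R. \<forall>x\<in>carrier A. X (r \<odot>\<^bsub>A\<^esub> x) = (r \<odot>\<^bsub>A\<^esub> \<one>\<^bsub>A\<^esub>) \<odot>\<^bsub>M\<^esub> X x) \<and>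
    (\<forall>x\<in>carrier A. \<forall>y\<in>carrier A. X (x \<otimes>\<^bsub>A\<^esub> y) = x \<odot>\<^bsub>M\<^esub> X y \<oplus>\<^bsub>M\<^esub> y \<odot>\<^bsub>M\<^esub> X x)"
  by (simp add: derivations_def module_homs_def)

text \<open>For \<open>derivations\<close> a scalar acts on values as multiplication by
  \<open>r \<odot> \<one>\<close>; in an algebra this is the given action, so \<open>X\<close>
  becomes plainly \<open>R\<close>-linear.\<close>

lemma Poiss_iff:
  assumes "algebra R A"
  shows "X \<in> Poiss R A br \<longleftrightarrow> X \<in> carrier A \<rightarrow>\<^sub>E carrier A \<and>
    (\<forall>x\<in>carrier A. \<forall>y\<in>carrier A. X (x \<oplus>\<^bsub>A\<^esub> y) = X x \<oplus>\<^bsub>A\<^esub> X y) \<and>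
    (\<forall>r\<in>carrier R. \<forall>x\<in>carrier A. X (r \<odot>\<^bsub>A\<^esub> x) = r \<odot>\<^bsub>A\<^esub> X x) \<and>
    (\<forall>x\<in>carrier A. \<forall>y\<in>carrier A. X (x \<otimes>\<^bsub>A\<^esub> y) = x \<otimes>\<^bsub>A\<^esub> X y \<oplus>\<^bsub>A\<^esub> y \<otimes>\<^bsub>A\<^esub> X x) \<and>
    (\<forall>x\<in>carrier A. \<forall>y\<in>carrier A. X (br x y) = br (X x) y \<oplus>\<^bsub>A\<^esub> br x (X y))"
proof -
  interpret A: algebra R A by fact
  have "(r \<odot>\<^bsub>A\<^esub> \<one>\<^bsub>A\<^esub>) \<otimes>\<^bsub>A\<^esub> X x = r \<odot>\<^bsub>A\<^esub> X x"
    if "X \<in> carrier A \<rightarrow>\<^sub>E carrier A" "r \<in> carrier R" "x \<in> carrier A" for r x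
    using that by (intro A.smult_one_mult) auto
  then show ?thesis
    by (auto simp: Poiss_def derivations_iff)
qed

section \<open>Poisson algebras\<close>

text \<open>The closure premises stand in for a module structure on \<open>M\<close> and
  \<open>N\<close>: the lemma is applied with Kaehler differentials on the left, about which only
  \<open>kaehler_d_closed\<close> is established.\<close>

lemma bilinear_mapD:
  assumes "bilinear_map R M N Q B" "x \<in> carrier M" "y \<in> carrier N"
  shows bilinear_map_closed: "B x y \<in> carrier Q"
    and bilinear_map_add_left: "x' \<in> carrier M \<Longrightarrow> x \<oplus>\<^bsub>M\<^esub> x' \<in> carrier M \<Longrightarrow> B (x \<oplus>\<^bsub>M\<^esub> x') y = B x y \<oplus>\<^bsub>Q\<^esub> B x' y"
    and bilinear_map_add_right: "y' \<in> carrier N \<Longrightarrow> y \<oplus>\<^bsub>N\<^esub> y' \<in> carrier N \<Longrightarrow> B x (y \<oplus>\<^bsub>N\<^esub> y') = B x y \<oplus>\<^bsub>Q\<^esub> B x y'"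
    and bilinear_map_smult_left: "r \<in> carrier R \<Longrightarrow> r \<odot>\<^bsub>M\<^esub> x \<in> carrier M \<Longrightarrow> B (r \<odot>\<^bsub>M\<^esub> x) y = r \<odot>\<^bsub>Q\<^esub> B x y"
    and bilinear_map_smult_right: "r \<in> carrier R \<Longrightarrow> r \<odot>\<^bsub>N\<^esub> y \<in> carrier N \<Longrightarrow> B x (r \<odot>\<^bsub>N\<^esub> y) = r \<odot>\<^bsub>Q\<^esub> B x y"
proof -
  from assms have l: "(\<lambda>x\<in>carrier M. B x y) \<in> module_homs R M Q"
    and r: "(\<lambda>y\<in>carrier N. B x y) \<in> module_homs R N Q"
    by (auto simp: bilinear_map_def)
  show "B x y \<in> carrier Q" using module_homsD(1)[OF l assms(2)] assms by simp
  show "x' \<in> carrier M \<Longrightarrow> x \<oplus>\<^bsub>M\<^esub> x' \<in> carrier M \<Longrightarrow> B (x \<oplus>\<^bsub>M\<^esub> x') y = B x y \<oplus>\<^bsub>Q\<^esub> B x' y"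
    using module_homsD(2)[OF l assms(2), of x'] assms by simp
  show "r \<in> carrier R \<Longrightarrow> r \<odot>\<^bsub>M\<^esub> x \<in> carrier M \<Longrightarrow> B (r \<odot>\<^bsub>M\<^esub> x) y = r \<odot>\<^bsub>Q\<^esub> B x y"
    using module_homsD(3)[OF l _ assms(2), of r] assms by simp
  show "y' \<in> carrier N \<Longrightarrow> y \<oplus>\<^bsub>N\<^esub> y' \<in> carrier N \<Longrightarrow> B x (y \<oplus>\<^bsub>N\<^esub> y') = B x y \<oplus>\<^bsub>Q\<^esub> B x y'"
    using module_homsD(2)[OF r assms(3), of y'] assms by simp
  show "r \<in> carrier R \<Longrightarrow> r \<odot>\<^bsub>N\<^esub> y \<in> carrier N \<Longrightarrow> B x (r \<odot>\<^bsub>N\<^esub> y) = r \<odot>\<^bsub>Q\<^esub> B x y"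
    using module_homsD(3)[OF r _ assms(3), of r] assms by simp
qed

locale lie_algebra = L: module R L for R :: "('r, 'x) ring_scheme" and L :: "('r, 'm) module" +
  fixes br :: "'m \<Rightarrow> 'm \<Rightarrow> 'm"
  assumes lie_bracket: "lie_bracket R L br"
begin

lemma bilinear: "bilinear_map R L L L br"
  using lie_bracket by (simp add: lie_bracket_def)

lemma br_closed [simp, intro]: "x \<in> carrier L \<Longrightarrow> y \<in> carrier L \<Longrightarrow> br x y \<in> carrier L"
  by (rule bilinear_map_closed[OF bilinear])

lemma br_linear:
  assumes "x \<in> carrier L" "y \<in> carrier L"
  shows "x' \<in> carrier L \<Longrightarrow> br (x \<oplus>\<^bsub>L\<^esub> x') y = br x y \<oplus>\<^bsub>L\<^esub> br x' y"
    and "y' \<in> carrier L \<Longrightarrow> br x (y \<oplus>\<^bsub>L\<^esub> y') = br x y \<oplus>\<^bsub>L\<^esub> br x y'"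
    and "r \<in> carrier R \<Longrightarrow> br (r \<odot>\<^bsub>L\<^esub> x) y = r \<odot>\<^bsub>L\<^esub> br x y"
    and "r \<in> carrier R \<Longrightarrow> br x (r \<odot>\<^bsub>L\<^esub> y) = r \<odot>\<^bsub>L\<^esub> br x y"
  using bilinear_mapD[OF bilinear assms] assms by simp_all

lemma br_zero [simp]:
  assumes "x \<in> carrier L"
  shows "br \<zero>\<^bsub>L\<^esub> x = \<zero>\<^bsub>L\<^esub>" "br x \<zero>\<^bsub>L\<^esub> = \<zero>\<^bsub>L\<^esub>"
  using br_linear(3,4)[of x x "\<zero>\<^bsub>R\<^esub>"] br_linear(3)[of "\<zero>\<^bsub>L\<^esub>" x "\<zero>\<^bsub>R\<^esub>"]
    br_linear(4)[of x "\<zero>\<^bsub>L\<^esub>" "\<zero>\<^bsub>R\<^esub>"] assms by simp_all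

text \<open>Polarization of the alternating law at \<open>x \<oplus> y\<close>.\<close>

lemma br_antisym:
  assumes "x \<in> carrier L" "y \<in> carrier L"
  shows "br y x = \<ominus>\<^bsub>L\<^esub> br x y"
proof -
  have sq: "br z z = \<zero>\<^bsub>L\<^esub>" if "z \<in> carrier L" for z
    using lie_bracket that by (simp add: lie_bracket_def)
  have "br (x \<oplus>\<^bsub>L\<^esub> y) (x \<oplus>\<^bsub>L\<^esub> y) = br x x \<oplus>\<^bsub>L\<^esub> br x y \<oplus>\<^bsub>L\<^esub> (br y x \<oplus>\<^bsub>L\<^esub> br y y)"
    using assms by (simp add: br_linear L.M.a_ac)
  then have "br y x \<oplus>\<^bsub>L\<^esub> br x y = \<zero>\<^bsub>L\<^esub>"
    using assms by (simp add: sq L.M.a_ac)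
  then show ?thesis using assms by (simp add: L.M.minus_equality)
qed

lemma br_minus:
  assumes "x \<in> carrier L" "y \<in> carrier L"
  shows "br (\<ominus>\<^bsub>L\<^esub> x) y = \<ominus>\<^bsub>L\<^esub> br x y" "br x (\<ominus>\<^bsub>L\<^esub> y) = \<ominus>\<^bsub>L\<^esub> br x y"
  using br_linear(3,4)[OF assms, of "\<ominus>\<^bsub>R\<^esub> \<one>\<^bsub>R\<^esub>"] assms by (simp_all add: L.smult_l_minus)

text \<open>The cyclic Jacobi identity in the form "bracketing with \<open>x\<close> is a derivation
  of the bracket", which is what makes Hamiltonian maps Poisson derivations.\<close>

lemma br_jacobi_derivation:
  assumes "x \<in> carrier L" "y \<in> carrier L" "z \<in> carrier L"
  shows "br x (br y z) = br (br x y) z \<oplus>\<^bsub>L\<^esub> br y (br x z)"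
proof -
  have "br x (br y z) \<oplus>\<^bsub>L\<^esub> br y (br z x) \<oplus>\<^bsub>L\<^esub> br z (br x y) = \<zero>\<^bsub>L\<^esub>"
    using lie_bracket assms by (simp add: lie_bracket_def)
  then have "br x (br y z) \<oplus>\<^bsub>L\<^esub> \<ominus>\<^bsub>L\<^esub> (br (br x y) z \<oplus>\<^bsub>L\<^esub> br y (br x z)) = \<zero>\<^bsub>L\<^esub>"
    using assms br_antisym[of x z] br_antisym[of "br x y" z]
    by (simp add: br_minus L.M.minus_add L.M.a_ac)
  then show ?thesis using assms
    by (metis L.M.a_closed L.M.a_inv_closed L.M.minus_equality L.M.minus_minus br_closed)
qed

end

locale poisson = A: algebra R A + lie_algebra R A br
  for R :: "('r, 'x) ring_scheme" and A :: "('r, 'a) module" and br :: "'a \<Rightarrow> 'a \<Rightarrow> 'a" +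
  assumes poisson: "poisson_algebra R A br"
begin

lemma br_mult:
  assumes "x \<in> carrier A" "y \<in> carrier A" "z \<in> carrier A"
  shows "br x (y \<otimes>\<^bsub>A\<^esub> z) = y \<otimes>\<^bsub>A\<^esub> br x z \<oplus>\<^bsub>A\<^esub> z \<otimes>\<^bsub>A\<^esub> br x y"
proof -
  have "(\<lambda>g\<in>carrier A. br x g) \<in> derivations R A (self_module A)"
    using poisson assms(1) by (simp add: poisson_algebra_def)
  then show ?thesis using assms(2,3) by (simp add: derivations_iff)
qed

lemma module_Poiss: "module R (fun_module (carrier A) A (Poiss R A br))"
proof (rule module_fun_module)
  note iff = Poiss_iff[OF A.algebra_axioms]
  show "Poiss R A br \<subseteq> carrier A \<rightarrow>\<^sub>E carrier A" using iff by blast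
  show "(\<lambda>x\<in>carrier A. \<zero>\<^bsub>A\<^esub>) \<in> Poiss R A br" by (auto simp: iff)
  show "(\<lambda>x\<in>carrier A. X x \<oplus>\<^bsub>A\<^esub> Y x) \<in> Poiss R A br"
    if X: "X \<in> Poiss R A br" and Y: "Y \<in> Poiss R A br" for X Y
  proof -
    have "X x \<in> carrier A" "Y x \<in> carrier A" if "x \<in> carrier A" for x
      using that X Y by (auto simp: iff)
    then show ?thesis using X Y unfolding iff
      by (auto simp: br_linear A.M.a_ac A.smult_r_distr A.r_distr)
  qed
  show "(\<lambda>x\<in>carrier A. r \<odot>\<^bsub>A\<^esub> X x) \<in> Poiss R A br"
    if r: "r \<in> carrier R" and X: "X \<in> Poiss R A br" for r X
  proof -
    have "X x \<in> carrier A" if "x \<in> carrier A" for x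
      using that X by (auto simp: iff)
    then show ?thesis using X r unfolding iff
      by (auto simp: br_linear A.smult_r_distr A.smult_assoc2' A.R.m_comm simp flip: A.smult_assoc1)
  qed
qed (rule A.module_axioms)

definition ham :: "'a \<Rightarrow> 'a \<Rightarrow> 'a" where
  "ham \<pi> = (\<lambda>x\<in>carrier A. br \<pi> x)"

lemma ham_Poiss: "\<pi> \<in> carrier A \<Longrightarrow> ham \<pi> \<in> Poiss R A br"
  by (auto simp: ham_def Poiss_iff[OF A.algebra_axioms] br_linear br_mult
      br_jacobi_derivation[of \<pi>])

lemma Ham_eq: "Ham A br = ham ` carrier A"
  by (simp add: Ham_def ham_def)

lemma ham_hom:
  assumes "ham ` carrier A \<subseteq> F"
  shows "(\<lambda>\<pi>\<in>carrier A. ham \<pi>) \<in> module_homs R A (fun_module (carrier A) A F)"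
  using assms by (intro module_homsI) (auto simp: ham_def br_linear intro!: restrict_ext)

text \<open>\<open>Ham\<close> is the image of the linear map \<open>ham\<close> defined on
  \<open>A\<close> itself. The set \<open>F\<close> is kept open so that the ambient module can be
  \<open>Poiss1\<close>.\<close>

lemma submodule_Ham:
  assumes "module R (fun_module (carrier A) A F)" "Ham A br \<subseteq> F"
  shows "submodule (Ham A br) R (fun_module (carrier A) A F)"
  using submodule_image[OF A.module_axioms assms(1) ham_hom A.carrier_is_submodule] assms(2)
  by (simp add: Ham_eq)

end

lemma poissonI: "poisson_algebra R A br \<Longrightarrow> poisson R A br"
  by (auto simp: poisson_algebra_def poisson_def lie_algebra_def lie_algebra_axioms_def
      poisson_axioms_def algebra.module)

lemma (in abelian_group) eq_iff_diff_zero: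
  assumes "x \<in> carrier G" "y \<in> carrier G"
  shows "x = y \<longleftrightarrow> x \<ominus> y = \<zero>"
  using assms by (metis minus_equality minus_eq minus_minus r_neg a_inv_closed)

section \<open>Admissible Poisson algebras\<close>

lemma semidirect_simps [simp]:
  "carrier (semidirect P0 P1) = carrier P0 \<times> carrier P1"
  "zero (semidirect P0 P1) = (\<zero>\<^bsub>P0\<^esub>, \<zero>\<^bsub>P1\<^esub>)"
  "(f, \<eta>) \<otimes>\<^bsub>semidirect P0 P1\<^esub> (g, \<xi>) = (f \<otimes>\<^bsub>P0\<^esub> g, f \<odot>\<^bsub>P1\<^esub> \<xi> \<oplus>\<^bsub>P1\<^esub> g \<odot>\<^bsub>P1\<^esub> \<eta>)"
  "(f, \<eta>) \<oplus>\<^bsub>semidirect P0 P1\<^esub> (g, \<xi>) = (f \<oplus>\<^bsub>P0\<^esub> g, \<eta> \<oplus>\<^bsub>P1\<^esub> \<xi>)"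
  "r \<odot>\<^bsub>semidirect P0 P1\<^esub> (f, \<eta>) = (r \<odot>\<^bsub>P0\<^esub> f, (r \<odot>\<^bsub>P0\<^esub> \<one>\<^bsub>P0\<^esub>) \<odot>\<^bsub>P1\<^esub> \<eta>)"
  by (simp_all add: semidirect_def)

text \<open>\<open>D\<close> and \<open>K\<close> are evaluated below on exact differentials, and
  this membership is what makes their bilinearity and skew-symmetry applicable there.\<close>

lemma kaehler_d_closed:
  assumes "cring A" "f \<in> carrier A"
  shows "kaehler_d R A f \<in> carrier (kaehler R A)"
proof -
  interpret A: cring A by fact
  \<comment> \<open>An inclusion rather than an equality: over the zero ring the support is
    empty.\<close>
  have "{x \<in> carrier A. basis_elem A f x \<noteq> \<zero>\<^bsub>A\<^esub>} \<subseteq> {f}"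
    by (auto simp: basis_elem_def)
  then have "finite {x \<in> carrier A. basis_elem A f x \<noteq> \<zero>\<^bsub>A\<^esub>}"
    using finite_subset by blast
  then have "basis_elem A f \<in> carrier (free_on_carrier A)"
    by (auto simp: free_on_carrier_def basis_elem_def)
  then show ?thesis by (auto simp: kaehler_def kaehler_d_def a_rcosets_eq_image)
qed

locale poisson_triple =
  fixes R :: "('r, 'x) ring_scheme" and P0 :: "('r, 'a) module" and P1 :: "('a, 'm) module"
    and br0 :: "'a \<Rightarrow> 'a \<Rightarrow> 'a" and br :: "'a \<times> 'm \<Rightarrow> 'a \<times> 'm \<Rightarrow> 'a \<times> 'm"
    and br1 :: "'m \<Rightarrow> 'm \<Rightarrow> 'm" and D :: "('a \<Rightarrow> 'a) set \<Rightarrow> 'm \<Rightarrow> 'm"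
    and K :: "('a \<Rightarrow> 'a) set \<Rightarrow> ('a \<Rightarrow> 'a) set \<Rightarrow> 'm"
  assumes admissible: "admissible_poisson_algebra R P0 P1 br0 br"
    and triple: "corresponding_poisson_triple R P0 P1 br0 br br1 D K"
begin

abbreviation "P \<equiv> semidirect P0 P1"
abbreviation "RP1 \<equiv> restrict_scalars P0 P1"
abbreviation Dd :: "'a \<Rightarrow> 'm \<Rightarrow> 'm" where "Dd f \<equiv> D (kaehler_d R P0 f)"
abbreviation Kd :: "'a \<Rightarrow> 'a \<Rightarrow> 'm" where "Kd f g \<equiv> K (kaehler_d R P0 f) (kaehler_d R P0 g)"
abbreviation rs :: "'r \<Rightarrow> 'm \<Rightarrow> 'm" where "rs r \<equiv> smult P1 (r \<odot>\<^bsub>P0\<^esub> \<one>\<^bsub>P0\<^esub>)"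

sublocale P0: poisson R P0 br0
  using admissible by (intro poissonI) (simp add: admissible_poisson_algebra_def)

sublocale P: poisson R P br
  using admissible by (intro poissonI) (simp add: admissible_poisson_algebra_def)

sublocale P1: lie_algebra P0 P1 br1
  using admissible triple
  by (simp add: admissible_poisson_algebra_def corresponding_poisson_triple_def
      lie_algebra_def lie_algebra_axioms_def faithful_module_def)

sublocale RP1: module R RP1
  by (rule module_restrict_scalars[OF P0.A.algebra_axioms P1.L.module_axioms])

lemma faithful: "f \<in> carrier P0 \<Longrightarrow> (\<And>\<eta>. \<eta> \<in> carrier P1 \<Longrightarrow> f \<odot>\<^bsub>P1\<^esub> \<eta> = \<zero>\<^bsub>P1\<^esub>) \<Longrightarrow> f = \<zero>\<^bsub>P0\<^esub>"
  using admissible by (auto simp: admissible_poisson_algebra_def faithful_module_def)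

lemma minus_zero [simp]: "\<ominus>\<^bsub>P1\<^esub> \<zero>\<^bsub>P1\<^esub> = \<zero>\<^bsub>P1\<^esub>"
  by (simp add: P1.L.M.minus_equality)

lemma br_eq:
  assumes "f \<in> carrier P0" "g \<in> carrier P0" "\<eta> \<in> carrier P1" "\<xi> \<in> carrier P1"
  shows "br (f, \<eta>) (g, \<xi>) = (br0 f g, Dd f \<xi> \<ominus>\<^bsub>P1\<^esub> Dd g \<eta> \<oplus>\<^bsub>P1\<^esub> br1 \<eta> \<xi> \<oplus>\<^bsub>P1\<^esub> Kd f g)"
  using triple assms by (simp add: corresponding_poisson_triple_def)

lemma contravariant_bilinear: "bilinear_map R (restrict_scalars P0 (kaehler R P0)) RP1 RP1 D"
  using triple by (simp add: corresponding_poisson_triple_def contravariant_derivative_def)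

lemma Dd_linear [simp]:
  assumes "f \<in> carrier P0" "\<eta> \<in> carrier P1"
  shows "Dd f \<eta> \<in> carrier P1"
    and "\<xi> \<in> carrier P1 \<Longrightarrow> Dd f (\<eta> \<oplus>\<^bsub>P1\<^esub> \<xi>) = Dd f \<eta> \<oplus>\<^bsub>P1\<^esub> Dd f \<xi>"
    and "r \<in> carrier R \<Longrightarrow> Dd f (rs r \<eta>) = rs r (Dd f \<eta>)"
  using bilinear_mapD[OF contravariant_bilinear _ , of "kaehler_d R P0 f" \<eta>] assms
    kaehler_d_closed[OF P0.A.M_cring assms(1), of R] by simp_all

lemma Dd_zero [simp]: "f \<in> carrier P0 \<Longrightarrow> Dd f \<zero>\<^bsub>P1\<^esub> = \<zero>\<^bsub>P1\<^esub>"
  using Dd_linear(2)[of f "\<zero>\<^bsub>P1\<^esub>" "\<zero>\<^bsub>P1\<^esub>"] Dd_linear(1)[of f "\<zero>\<^bsub>P1\<^esub>"]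
  by (metis P1.L.M.add.r_cancel_one' P1.L.M.l_zero P1.L.M.zero_closed)

lemma Dd_minus [simp]:
  assumes "f \<in> carrier P0" "\<eta> \<in> carrier P1"
  shows "Dd f (\<ominus>\<^bsub>P1\<^esub> \<eta>) = \<ominus>\<^bsub>P1\<^esub> Dd f \<eta>"
  using Dd_linear(2)[of f "\<ominus>\<^bsub>P1\<^esub> \<eta>" \<eta>] assms
  by (simp add: P1.L.M.l_neg P1.L.M.minus_equality)

lemma Kd_closed [simp]:
  assumes "f \<in> carrier P0" "g \<in> carrier P0"
  shows "Kd f g \<in> carrier P1"
proof -
  have "bilinear_map P0 (kaehler R P0) (kaehler R P0) P1 K"
    using triple by (simp add: corresponding_poisson_triple_def)
  then show ?thesis
    using bilinear_map_closed kaehler_d_closed[OF P0.A.M_cring] assms by metis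
qed

lemma Kd_skew: "f \<in> carrier P0 \<Longrightarrow> g \<in> carrier P0 \<Longrightarrow> Kd g f = \<ominus>\<^bsub>P1\<^esub> Kd f g"
  using triple kaehler_d_closed[OF P0.A.M_cring] unfolding corresponding_poisson_triple_def by blast

text \<open>The differential of zero is not computed among the Kaehler differentials; the value is
  read off from the vanishing of the bracket of \<open>(f, \<zero>)\<close> with zero.
  \<open>Dd_zero_left\<close> is obtained in the same way.\<close>

lemma Kd_zero [simp]:
  assumes "f \<in> carrier P0"
  shows "Kd f \<zero>\<^bsub>P0\<^esub> = \<zero>\<^bsub>P1\<^esub>" "Kd \<zero>\<^bsub>P0\<^esub> f = \<zero>\<^bsub>P1\<^esub>"
proof -
  show *: "Kd f \<zero>\<^bsub>P0\<^esub> = \<zero>\<^bsub>P1\<^esub>"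
    using P.br_zero(2)[of "(f, \<zero>\<^bsub>P1\<^esub>)"] assms by (simp add: br_eq P1.L.M.minus_eq)
  show "Kd \<zero>\<^bsub>P0\<^esub> f = \<zero>\<^bsub>P1\<^esub>"
    using Kd_skew[of f "\<zero>\<^bsub>P0\<^esub>"] assms by (simp add: *)
qed

lemma Dd_zero_left [simp]: "\<eta> \<in> carrier P1 \<Longrightarrow> Dd \<zero>\<^bsub>P0\<^esub> \<eta> = \<zero>\<^bsub>P1\<^esub>"
  using P.br_zero(1)[of "(\<zero>\<^bsub>P0\<^esub>, \<eta>)"] by (simp add: br_eq P1.L.M.minus_eq)

text \<open>The entries \<open>X\<^sub>0\<^sub>0 = l\<close>, \<open>X\<^sub>1\<^sub>0 = c\<close>, \<open>X\<^sub>1\<^sub>1 = L\<close> of an element of \<open>Poiss1\<close>; in \<open>frakM\<close>, \<open>\<theta> = - c\<close>.\<close>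

definition Poiss1_entries :: "('a \<Rightarrow> 'a) \<Rightarrow> ('a \<Rightarrow> 'm) \<Rightarrow> ('m \<Rightarrow> 'm) \<Rightarrow> bool" where
  "Poiss1_entries l c L \<longleftrightarrow> l \<in> Poiss R P0 br0 \<and> c \<in> derivations R P0 P1 \<and>
    generalized_derivation R P0 P1 l L \<and>
    (\<forall>\<eta>\<in>carrier P1. \<forall>\<xi>\<in>carrier P1. L (br1 \<eta> \<xi>) = br1 (L \<eta>) \<xi> \<oplus>\<^bsub>P1\<^esub> br1 \<eta> (L \<xi>)) \<and>
    (\<forall>f\<in>carrier P0. \<forall>\<xi>\<in>carrier P1. L (Dd f \<xi>) = Dd (l f) \<xi> \<oplus>\<^bsub>P1\<^esub> br1 (c f) \<xi> \<oplus>\<^bsub>P1\<^esub> Dd f (L \<xi>)) \<and>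
    (\<forall>f\<in>carrier P0. \<forall>g\<in>carrier P0. c (br0 f g) \<oplus>\<^bsub>P1\<^esub> L (Kd f g) =
      (Kd (l f) g \<ominus>\<^bsub>P1\<^esub> Dd g (c f)) \<oplus>\<^bsub>P1\<^esub> (Dd f (c g) \<oplus>\<^bsub>P1\<^esub> Kd f (l g)))"

definition entries_map :: "('a \<Rightarrow> 'a) \<Rightarrow> ('a \<Rightarrow> 'm) \<Rightarrow> ('m \<Rightarrow> 'm) \<Rightarrow> 'a \<times> 'm \<Rightarrow> 'a \<times> 'm" where
  "entries_map l c L = block_map P0 P1 l (\<lambda>_. \<zero>\<^bsub>P0\<^esub>) c L"

lemma entries_map_apply:
  assumes "f \<in> carrier P0" "\<eta> \<in> carrier P1" "l f \<in> carrier P0"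
  shows "entries_map l c L (f, \<eta>) = (l f, c f \<oplus>\<^bsub>P1\<^esub> L \<eta>)"
  using assms by (simp add: entries_map_def block_map_def)

lemma entries_map_extensional [simp]: "entries_map l c L \<in> extensional (carrier P0 \<times> carrier P1)"
  by (simp add: entries_map_def block_map_def)

text \<open>Each condition on the entries is the Poisson condition on a pair of pure elements; by
  additivity they combine to the condition on arbitrary pairs.\<close>

lemma entries_map_Poiss1:
  assumes "Poiss1_entries l c L"
  shows "entries_map l c L \<in> Poiss1 R P0 P1 br"
proof -
  have l: "l \<in> Poiss R P0 br0" and c: "c \<in> derivations R P0 P1"
    and L: "generalized_derivation R P0 P1 l L"
    and L1: "\<And>\<eta> \<xi>. \<eta> \<in> carrier P1 \<Longrightarrow> \<xi> \<in> carrier P1 \<Longrightarrow> L (br1 \<eta> \<xi>) = br1 (L \<eta>) \<xi> \<oplus>\<^bsub>P1\<^esub> br1 \<eta> (L \<xi>)"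
    and L2: "\<And>f \<xi>. f \<in> carrier P0 \<Longrightarrow> \<xi> \<in> carrier P1 \<Longrightarrow> L (Dd f \<xi>) = Dd (l f) \<xi> \<oplus>\<^bsub>P1\<^esub> br1 (c f) \<xi> \<oplus>\<^bsub>P1\<^esub> Dd f (L \<xi>)"
    and L3: "\<And>f g. f \<in> carrier P0 \<Longrightarrow> g \<in> carrier P0 \<Longrightarrow> c (br0 f g) \<oplus>\<^bsub>P1\<^esub> L (Kd f g) =
      (Kd (l f) g \<ominus>\<^bsub>P1\<^esub> Dd g (c f)) \<oplus>\<^bsub>P1\<^esub> (Dd f (c g) \<oplus>\<^bsub>P1\<^esub> Kd f (l g))"
    using assms by (auto simp: Poiss1_entries_def)
  note lD = l[unfolded Poiss_iff[OF P0.A.algebra_axioms]]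
  note cD = c[unfolded derivations_iff]
  have lc [simp]: "l f \<in> carrier P0" and cc [simp]: "c f \<in> carrier P1" if "f \<in> carrier P0" for f
    using that lD cD by auto
  have L_hom: "L \<in> module_homs R RP1 RP1" and
    L_mult: "\<And>f \<eta>. f \<in> carrier P0 \<Longrightarrow> \<eta> \<in> carrier P1 \<Longrightarrow> L (f \<odot>\<^bsub>P1\<^esub> \<eta>) = f \<odot>\<^bsub>P1\<^esub> L \<eta> \<oplus>\<^bsub>P1\<^esub> l f \<odot>\<^bsub>P1\<^esub> \<eta>"
    using L by (auto simp: generalized_derivation_def)
  note LD = module_homsD(1-3)[OF L_hom, simplified]
  have L0: "L \<zero>\<^bsub>P1\<^esub> = \<zero>\<^bsub>P1\<^esub>"
    using module_homs_zero[OF RP1.M.abelian_group_axioms RP1.M.abelian_group_axioms L_hom] by simp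
  have Lm: "L (\<ominus>\<^bsub>P1\<^esub> \<eta>) = \<ominus>\<^bsub>P1\<^esub> L \<eta>" if "\<eta> \<in> carrier P1" for \<eta>
    using LD(2)[of "\<ominus>\<^bsub>P1\<^esub> \<eta>" \<eta>] that LD(1) by (simp add: P1.L.M.l_neg L0 P1.L.M.minus_equality)
  let ?X = "entries_map l c L"
  have l0: "l \<zero>\<^bsub>P0\<^esub> = \<zero>\<^bsub>P0\<^esub>"
    using lD P0.A.M.add.r_cancel_one'[of "l \<zero>\<^bsub>P0\<^esub>" "l \<zero>\<^bsub>P0\<^esub>"] by (metis P0.A.M.l_zero P0.A.M.zero_closed lc)
  show ?thesis
    unfolding Poiss1_def Poiss_iff[OF P.A.algebra_axioms]
  proof (intro CollectI conjI ballI)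
    show "?X \<in> carrier P \<rightarrow>\<^sub>E carrier P"
      using LD(1) by (auto simp: PiE_iff entries_map_apply)
    fix x assume "x \<in> carrier P"
    then obtain f \<eta> where x: "x = (f, \<eta>)" "f \<in> carrier P0" "\<eta> \<in> carrier P1" by auto
    show "?X (r \<odot>\<^bsub>P\<^esub> x) = r \<odot>\<^bsub>P\<^esub> ?X x" if "r \<in> carrier R" for r
      using x that lD cD by (simp add: entries_map_apply LD P1.L.smult_r_distr)
    fix y assume "y \<in> carrier P"
    then obtain g \<xi> where y: "y = (g, \<xi>)" "g \<in> carrier P0" "\<xi> \<in> carrier P1" by auto
    show "?X (x \<oplus>\<^bsub>P\<^esub> y) = ?X x \<oplus>\<^bsub>P\<^esub> ?X y"
      using x y lD cD by (simp add: entries_map_apply LD P1.L.M.a_ac)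
    show "?X (x \<otimes>\<^bsub>P\<^esub> y) = x \<otimes>\<^bsub>P\<^esub> ?X y \<oplus>\<^bsub>P\<^esub> y \<otimes>\<^bsub>P\<^esub> ?X x"
      using x y lD cD by (simp add: entries_map_apply LD L_mult P1.L.smult_r_distr P1.L.M.a_ac)
    \<comment> \<open>The second component of \<open>?X (br x y)\<close>, regrouped so that
      \<open>L3\<close> meets the pair \<open>f, g\<close>, \<open>L2\<close> the two mixed pairs
      and \<open>L1\<close> the pair \<open>\<eta>, \<xi>\<close>.\<close>
    have "c (br0 f g) \<oplus>\<^bsub>P1\<^esub> L (Dd f \<xi> \<ominus>\<^bsub>P1\<^esub> Dd g \<eta> \<oplus>\<^bsub>P1\<^esub> br1 \<eta> \<xi> \<oplus>\<^bsub>P1\<^esub> Kd f g)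
        = (c (br0 f g) \<oplus>\<^bsub>P1\<^esub> L (Kd f g)) \<oplus>\<^bsub>P1\<^esub>
          (L (Dd f \<xi>) \<ominus>\<^bsub>P1\<^esub> L (Dd g \<eta>) \<oplus>\<^bsub>P1\<^esub> L (br1 \<eta> \<xi>))"
      using x y by (simp add: P1.L.M.minus_eq LD Lm P1.L.M.a_ac)
    \<comment> \<open>\<open>L2\<close> for \<open>g\<close> enters with a minus sign and
      contributes \<open>- br1 (c g) \<eta>\<close>; antisymmetry turns this into the term
      \<open>br1 \<eta> (c g)\<close> of the second bracket.\<close>
    also have "\<dots> = (Dd (l f) \<xi> \<ominus>\<^bsub>P1\<^esub> Dd g (c f \<oplus>\<^bsub>P1\<^esub> L \<eta>) \<oplus>\<^bsub>P1\<^esub> br1 (c f \<oplus>\<^bsub>P1\<^esub> L \<eta>) \<xi> \<oplus>\<^bsub>P1\<^esub> Kd (l f) g) \<oplus>\<^bsub>P1\<^esub>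
         (Dd f (c g \<oplus>\<^bsub>P1\<^esub> L \<xi>) \<ominus>\<^bsub>P1\<^esub> Dd (l g) \<eta> \<oplus>\<^bsub>P1\<^esub> br1 \<eta> (c g \<oplus>\<^bsub>P1\<^esub> L \<xi>) \<oplus>\<^bsub>P1\<^esub> Kd f (l g))"
      using x y
      by (simp add: L1 L2 L3 P1.L.M.minus_eq LD P1.L.M.minus_add P1.br_linear P1.br_antisym[of "c g" \<eta>] P1.L.M.a_ac)
    finally show "?X (br x y) = br (?X x) y \<oplus>\<^bsub>P\<^esub> br x (?X y)"
      using x y lD by (simp add: entries_map_apply br_eq LD P1.L.M.minus_eq)
  next
    show "fst (?X (\<zero>\<^bsub>P0\<^esub>, \<eta>)) = \<zero>\<^bsub>P0\<^esub>" if "\<eta> \<in> carrier P1" for \<eta>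
      using that by (simp add: entries_map_apply l0)
  qed
qed


definition entry00 :: "('a \<times> 'm \<Rightarrow> 'a \<times> 'm) \<Rightarrow> 'a \<Rightarrow> 'a" where
  "entry00 X = (\<lambda>f\<in>carrier P0. fst (X (f, \<zero>\<^bsub>P1\<^esub>)))"

definition entry10 :: "('a \<times> 'm \<Rightarrow> 'a \<times> 'm) \<Rightarrow> 'a \<Rightarrow> 'm" where
  "entry10 X = (\<lambda>f\<in>carrier P0. snd (X (f, \<zero>\<^bsub>P1\<^esub>)))"

definition entry11 :: "('a \<times> 'm \<Rightarrow> 'a \<times> 'm) \<Rightarrow> 'm \<Rightarrow> 'm" where
  "entry11 X = (\<lambda>\<eta>\<in>carrier P1. snd (X (\<zero>\<^bsub>P0\<^esub>, \<eta>)))"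

lemma Poiss1_entries:
  assumes "X \<in> Poiss1 R P0 P1 br"
  shows "Poiss1_entries (entry00 X) (entry10 X) (entry11 X)"
    and "X = entries_map (entry00 X) (entry10 X) (entry11 X)"
proof -
  define l c L where def: "l = entry00 X" "c = entry10 X" "L = entry11 X"
  from assms have X: "X \<in> Poiss R P br" and X01: "\<And>\<eta>. \<eta> \<in> carrier P1 \<Longrightarrow> fst (X (\<zero>\<^bsub>P0\<^esub>, \<eta>)) = \<zero>\<^bsub>P0\<^esub>"
    by (auto simp: Poiss1_def)
  note X' = X[unfolded Poiss_iff[OF P.A.algebra_axioms]]
  have X_closed: "X x \<in> carrier P" if "x \<in> carrier P" for x using X' that by blast
  have X_add: "X (x \<oplus>\<^bsub>P\<^esub> y) = X x \<oplus>\<^bsub>P\<^esub> X y" and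
    X_mult: "X (x \<otimes>\<^bsub>P\<^esub> y) = x \<otimes>\<^bsub>P\<^esub> X y \<oplus>\<^bsub>P\<^esub> y \<otimes>\<^bsub>P\<^esub> X x" and
    X_br: "X (br x y) = br (X x) y \<oplus>\<^bsub>P\<^esub> br x (X y)"
    if "x \<in> carrier P" "y \<in> carrier P" for x y using X' that by blast+
  have X_smult: "X (r \<odot>\<^bsub>P\<^esub> x) = r \<odot>\<^bsub>P\<^esub> X x" if "r \<in> carrier R" "x \<in> carrier P" for r x
    using X' that by blast
  have X0: "X (f, \<zero>\<^bsub>P1\<^esub>) = (l f, c f)" and lc [simp]: "l f \<in> carrier P0" and cc [simp]: "c f \<in> carrier P1"
    if "f \<in> carrier P0" for f
    using X_closed[of "(f, \<zero>\<^bsub>P1\<^esub>)"] that by (auto simp: def entry00_def entry10_def)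
  have X1: "X (\<zero>\<^bsub>P0\<^esub>, \<eta>) = (\<zero>\<^bsub>P0\<^esub>, L \<eta>)" and Lc [simp]: "L \<eta> \<in> carrier P1"
    if "\<eta> \<in> carrier P1" for \<eta>
    using X_closed[of "(\<zero>\<^bsub>P0\<^esub>, \<eta>)"] that X01[OF that] by (auto simp: def entry11_def prod_eq_iff)
  have L0 [simp]: "L \<zero>\<^bsub>P1\<^esub> = \<zero>\<^bsub>P1\<^esub>"
    using X_add[of "(\<zero>\<^bsub>P0\<^esub>, \<zero>\<^bsub>P1\<^esub>)" "(\<zero>\<^bsub>P0\<^esub>, \<zero>\<^bsub>P1\<^esub>)"] P1.L.M.add.r_cancel_one'[of "L \<zero>\<^bsub>P1\<^esub>" "L \<zero>\<^bsub>P1\<^esub>"]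
    by (simp add: X1)
  have X_eq: "X (f, \<eta>) = (l f, c f \<oplus>\<^bsub>P1\<^esub> L \<eta>)" if "f \<in> carrier P0" "\<eta> \<in> carrier P1" for f \<eta>
    using X_add[of "(f, \<zero>\<^bsub>P1\<^esub>)" "(\<zero>\<^bsub>P0\<^esub>, \<eta>)"] that by (simp add: X0 X1)
  have "X = entries_map l c L"
  proof (rule extensionalityI)
    show "X \<in> extensional (carrier P0 \<times> carrier P1)" using X' by (auto simp: PiE_iff)
  qed (auto simp: X_eq entries_map_apply)
  then show "X = entries_map (entry00 X) (entry10 X) (entry11 X)" by (simp add: def)
  have l: "l \<in> Poiss R P0 br0"
    unfolding Poiss_iff[OF P0.A.algebra_axioms]
  proof (intro conjI ballI)
    show "l \<in> carrier P0 \<rightarrow>\<^sub>E carrier P0" by (auto simp: PiE_iff) (simp add: def entry00_def)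
    fix f assume f: "f \<in> carrier P0"
    show "l (r \<odot>\<^bsub>P0\<^esub> f) = r \<odot>\<^bsub>P0\<^esub> l f" if "r \<in> carrier R" for r
      using X_smult[of r "(f, \<zero>\<^bsub>P1\<^esub>)"] f that by (simp add: X0)
    fix g assume g: "g \<in> carrier P0"
    show "l (f \<oplus>\<^bsub>P0\<^esub> g) = l f \<oplus>\<^bsub>P0\<^esub> l g"
      using X_add[of "(f, \<zero>\<^bsub>P1\<^esub>)" "(g, \<zero>\<^bsub>P1\<^esub>)"] f g by (simp add: X0)
    show "l (f \<otimes>\<^bsub>P0\<^esub> g) = f \<otimes>\<^bsub>P0\<^esub> l g \<oplus>\<^bsub>P0\<^esub> g \<otimes>\<^bsub>P0\<^esub> l f"
      using X_mult[of "(f, \<zero>\<^bsub>P1\<^esub>)" "(g, \<zero>\<^bsub>P1\<^esub>)"] f g by (simp add: X0)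
    show "l (br0 f g) = br0 (l f) g \<oplus>\<^bsub>P0\<^esub> br0 f (l g)"
      using X_br[of "(f, \<zero>\<^bsub>P1\<^esub>)" "(g, \<zero>\<^bsub>P1\<^esub>)"] f g
      by (simp add: X_eq br_eq P1.L.M.minus_eq)
  qed
  moreover have c: "c \<in> derivations R P0 P1"
    unfolding derivations_iff
  proof (intro conjI ballI)
    show "c \<in> carrier P0 \<rightarrow>\<^sub>E carrier P1" by (auto simp: PiE_iff) (simp add: def entry10_def)
    fix f assume f: "f \<in> carrier P0"
    show "c (r \<odot>\<^bsub>P0\<^esub> f) = rs r (c f)" if "r \<in> carrier R" for r
      using X_smult[of r "(f, \<zero>\<^bsub>P1\<^esub>)"] f that by (simp add: X0)
    fix g assume g: "g \<in> carrier P0"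
    show "c (f \<oplus>\<^bsub>P0\<^esub> g) = c f \<oplus>\<^bsub>P1\<^esub> c g"
      using X_add[of "(f, \<zero>\<^bsub>P1\<^esub>)" "(g, \<zero>\<^bsub>P1\<^esub>)"] f g by (simp add: X0)
    show "c (f \<otimes>\<^bsub>P0\<^esub> g) = f \<odot>\<^bsub>P1\<^esub> c g \<oplus>\<^bsub>P1\<^esub> g \<odot>\<^bsub>P1\<^esub> c f"
      using X_mult[of "(f, \<zero>\<^bsub>P1\<^esub>)" "(g, \<zero>\<^bsub>P1\<^esub>)"] f g by (simp add: X0)
  qed
  moreover have "generalized_derivation R P0 P1 l L"
    unfolding generalized_derivation_def
  proof (intro conjI ballI)
    show "L \<in> module_homs R RP1 RP1"
    proof (rule module_homsI)
      fix \<eta> assume "\<eta> \<in> carrier RP1"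
      then have \<eta>: "\<eta> \<in> carrier P1" by simp
      then show "L \<eta> \<in> carrier RP1" by simp
      show "L (r \<odot>\<^bsub>RP1\<^esub> \<eta>) = r \<odot>\<^bsub>RP1\<^esub> L \<eta>" if "r \<in> carrier R" for r
        using X_smult[of r "(\<zero>\<^bsub>P0\<^esub>, \<eta>)"] \<eta> that by (simp add: X1)
      show "L (\<eta> \<oplus>\<^bsub>RP1\<^esub> \<xi>) = L \<eta> \<oplus>\<^bsub>RP1\<^esub> L \<xi>" if "\<xi> \<in> carrier RP1" for \<xi>
        using X_add[of "(\<zero>\<^bsub>P0\<^esub>, \<eta>)" "(\<zero>\<^bsub>P0\<^esub>, \<xi>)"] \<eta> that by (simp add: X1)
    qed (simp add: def entry11_def)
    fix f \<eta> assume "f \<in> carrier P0" "\<eta> \<in> carrier P1"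
    then show "L (f \<odot>\<^bsub>P1\<^esub> \<eta>) = f \<odot>\<^bsub>P1\<^esub> L \<eta> \<oplus>\<^bsub>P1\<^esub> l f \<odot>\<^bsub>P1\<^esub> \<eta>"
      using X_mult[of "(f, \<zero>\<^bsub>P1\<^esub>)" "(\<zero>\<^bsub>P0\<^esub>, \<eta>)"] by (simp add: X0 X1)
  qed
  moreover have "L (br1 \<eta> \<xi>) = br1 (L \<eta>) \<xi> \<oplus>\<^bsub>P1\<^esub> br1 \<eta> (L \<xi>)"
    if "\<eta> \<in> carrier P1" "\<xi> \<in> carrier P1" for \<eta> \<xi>
    using X_br[of "(\<zero>\<^bsub>P0\<^esub>, \<eta>)" "(\<zero>\<^bsub>P0\<^esub>, \<xi>)"] that by (simp add: X1 br_eq P1.L.M.minus_eq)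
  moreover have "L (Dd f \<xi>) = Dd (l f) \<xi> \<oplus>\<^bsub>P1\<^esub> br1 (c f) \<xi> \<oplus>\<^bsub>P1\<^esub> Dd f (L \<xi>)"
    if "f \<in> carrier P0" "\<xi> \<in> carrier P1" for f \<xi>
    using X_br[of "(f, \<zero>\<^bsub>P1\<^esub>)" "(\<zero>\<^bsub>P0\<^esub>, \<xi>)"] that
    by (simp add: X0 X1 br_eq P1.L.M.minus_eq)
  moreover have "c (br0 f g) \<oplus>\<^bsub>P1\<^esub> L (Kd f g) =
      (Kd (l f) g \<ominus>\<^bsub>P1\<^esub> Dd g (c f)) \<oplus>\<^bsub>P1\<^esub> (Dd f (c g) \<oplus>\<^bsub>P1\<^esub> Kd f (l g))"
    if "f \<in> carrier P0" "g \<in> carrier P0" for f g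
    using X_br[of "(f, \<zero>\<^bsub>P1\<^esub>)" "(g, \<zero>\<^bsub>P1\<^esub>)"] that
    by (simp add: X_eq br_eq P1.L.M.minus_eq P1.L.M.a_comm[of "\<ominus>\<^bsub>P1\<^esub> Dd g (c f)" "Kd (l f) g"])
  ultimately show "Poiss1_entries (entry00 X) (entry10 X) (entry11 X)"
    unfolding Poiss1_entries_def def by blast
qed

section \<open>The module of block triangular Poisson derivations\<close>

abbreviation "Poiss1_module \<equiv> fun_module (carrier P) P (Poiss1 R P0 P1 br)"

lemma fst_snd_semidirect [simp]:
  "fst (x \<oplus>\<^bsub>P\<^esub> y) = fst x \<oplus>\<^bsub>P0\<^esub> fst y" "snd (x \<oplus>\<^bsub>P\<^esub> y) = snd x \<oplus>\<^bsub>P1\<^esub> snd y"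
  "fst (r \<odot>\<^bsub>P\<^esub> x) = r \<odot>\<^bsub>P0\<^esub> fst x" "snd (r \<odot>\<^bsub>P\<^esub> x) = rs r (snd x)"
  by (cases x; cases y; simp)+

text \<open>Closure is inherited from \<open>Poiss\<close>; the additional requirement that the
  upper right entry vanish is linear.\<close>

lemma module_Poiss1: "module R Poiss1_module"
proof (rule module_fun_module)
  interpret M: module R "fun_module (carrier P) P (Poiss R P br)" by (rule P.module_Poiss)
  show "Poiss1 R P0 P1 br \<subseteq> carrier P \<rightarrow>\<^sub>E carrier P"
    by (auto simp: Poiss1_def Poiss_iff[OF P.A.algebra_axioms])
  show "(\<lambda>x\<in>carrier P. \<zero>\<^bsub>P\<^esub>) \<in> Poiss1 R P0 P1 br"
    using M.M.zero_closed by (simp add: Poiss1_def)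
  show "(\<lambda>x\<in>carrier P. X x \<oplus>\<^bsub>P\<^esub> Y x) \<in> Poiss1 R P0 P1 br"
    if "X \<in> Poiss1 R P0 P1 br" "Y \<in> Poiss1 R P0 P1 br" for X Y
    using that M.M.a_closed[of X Y] by (simp add: Poiss1_def)
  show "(\<lambda>x\<in>carrier P. r \<odot>\<^bsub>P\<^esub> X x) \<in> Poiss1 R P0 P1 br"
    if "r \<in> carrier R" "X \<in> Poiss1 R P0 P1 br" for r X
    using that M.smult_closed[of r X] by (simp add: Poiss1_def)
qed (rule P.A.module_axioms)

text \<open>The upper right entry of \<open>ham (h, \<zeta>)\<close> has the value
  \<open>br0 h \<zero>\<close>.\<close>

lemma Ham_Poiss1: "Ham P br \<subseteq> Poiss1 R P0 P1 br"
  using P.ham_Poiss by (auto simp: P.Ham_eq Poiss1_def P.ham_def br_eq)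

lemma submodule_Ham: "submodule (Ham P br) R Poiss1_module"
  by (rule P.submodule_Ham[OF module_Poiss1 Ham_Poiss1])

text \<open>For the forward direction the entries of the block map must be recovered as
  \<open>l\<close>, \<open>c\<close>, \<open>L\<close>. Its \<open>entry10\<close> is
  \<open>c f \<oplus> L \<zero>\<close>, whence the assumption on \<open>L \<zero>\<close>. Its
  \<open>entry11\<close> is \<open>c \<zero> \<oplus> L \<eta>\<close>, and
  \<open>c \<zero> = \<zero>\<close> follows from additivity of \<open>entry10\<close>.\<close>

lemma entries_map_Poiss1_iff:
  assumes "l \<in> carrier P0 \<rightarrow>\<^sub>E carrier P0" "c \<in> carrier P0 \<rightarrow>\<^sub>E carrier P1" "L \<in> carrier P1 \<rightarrow>\<^sub>E carrier P1"
    and "L \<zero>\<^bsub>P1\<^esub> = \<zero>\<^bsub>P1\<^esub>"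
  shows "entries_map l c L \<in> Poiss1 R P0 P1 br \<longleftrightarrow> Poiss1_entries l c L"
proof
  let ?X = "entries_map l c L"
  assume X: "?X \<in> Poiss1 R P0 P1 br"
  have cl: "l f \<in> carrier P0" "c f \<in> carrier P1" if "f \<in> carrier P0" for f using assms that by auto
  have Lc: "L \<eta> \<in> carrier P1" if "\<eta> \<in> carrier P1" for \<eta> using assms that by auto
  have c_add: "c (f \<oplus>\<^bsub>P0\<^esub> g) = c f \<oplus>\<^bsub>P1\<^esub> c g" if "f \<in> carrier P0" "g \<in> carrier P0" for f g
    using Poiss1_entries(1)[OF X] cl assms(4) that
    by (simp add: Poiss1_entries_def derivations_iff entry10_def entries_map_apply)
  have c0: "c \<zero>\<^bsub>P0\<^esub> = \<zero>\<^bsub>P1\<^esub>"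
    using c_add[of "\<zero>\<^bsub>P0\<^esub>" "\<zero>\<^bsub>P0\<^esub>"] cl(2)[of "\<zero>\<^bsub>P0\<^esub>"]
      P1.L.M.add.r_cancel_one'[of "c \<zero>\<^bsub>P0\<^esub>" "c \<zero>\<^bsub>P0\<^esub>"] by simp
  have "entry00 ?X = l"
    using assms cl by (intro extensionalityI[of _ "carrier P0"]) (auto simp: entry00_def entries_map_apply PiE_iff)
  moreover have "entry10 ?X = c"
    using assms cl by (intro extensionalityI[of _ "carrier P0"]) (auto simp: entry10_def entries_map_apply PiE_iff)
  moreover have "entry11 ?X = L"
    using assms cl Lc c0 by (intro extensionalityI[of _ "carrier P1"]) (auto simp: entry11_def entries_map_apply PiE_iff)
  ultimately show "Poiss1_entries l c L" using Poiss1_entries(1)[OF X] by simp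
qed (rule entries_map_Poiss1)

lemma Poiss1_entriesD:
  assumes "Poiss1_entries l c L"
  shows "l \<in> carrier P0 \<rightarrow>\<^sub>E carrier P0" "c \<in> carrier P0 \<rightarrow>\<^sub>E carrier P1" "L \<in> carrier P1 \<rightarrow>\<^sub>E carrier P1"
    "c \<zero>\<^bsub>P0\<^esub> = \<zero>\<^bsub>P1\<^esub>" "L \<zero>\<^bsub>P1\<^esub> = \<zero>\<^bsub>P1\<^esub>"
proof -
  have l: "l \<in> Poiss R P0 br0" and c: "c \<in> module_homs R P0 RP1" and L: "L \<in> module_homs R RP1 RP1"
    using assms by (auto simp: Poiss1_entries_def derivations_def generalized_derivation_def)
  show "l \<in> carrier P0 \<rightarrow>\<^sub>E carrier P0" using l by (simp add: Poiss_iff[OF P0.A.algebra_axioms])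
  show "c \<in> carrier P0 \<rightarrow>\<^sub>E carrier P1" "L \<in> carrier P1 \<rightarrow>\<^sub>E carrier P1"
    using c L by (auto simp: module_homs_def)
  show "c \<zero>\<^bsub>P0\<^esub> = \<zero>\<^bsub>P1\<^esub>" "L \<zero>\<^bsub>P1\<^esub> = \<zero>\<^bsub>P1\<^esub>"
    using module_homs_zero[OF P0.A.M.abelian_group_axioms RP1.M.abelian_group_axioms c]
      module_homs_zero[OF RP1.M.abelian_group_axioms RP1.M.abelian_group_axioms L] by simp_all
qed

lemma entry11_entries_map:
  assumes "Poiss1_entries l c L"
  shows "entry11 (entries_map l c L) = L"
proof (rule extensionalityI)
  note e = Poiss1_entriesD[OF assms]
  show "L \<in> extensional (carrier P1)" using e by (simp add: PiE_iff)
  fix \<eta> assume "\<eta> \<in> carrier P1"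
  then show "entry11 (entries_map l c L) \<eta> = L \<eta>"
    using e PiE_mem[OF e(1)] PiE_mem[OF e(3)] by (simp add: entry11_def entries_map_apply)
qed (simp add: entry11_def)

section \<open>\<open>frakM\<close> as the set of lower right entries\<close>

text \<open>In both cases the two sides are the same equation with all terms collected. The
  commutator in \<open>frakM\<close> carries \<open>L (Dd f \<xi>)\<close> with a minus sign, while
  the entry condition is solved for it; hence the entry condition is collected with the opposite
  sign (\<open>neg\<close>) in the first equivalence. The bracket term then matches exactly when
  \<open>\<theta>\<close> is minus \<open>c\<close>, and the same choice fits the \<open>K\<close>
  condition.\<close>

lemma frakM_conditions_iff:
  assumes "\<And>f. f \<in> carrier P0 \<Longrightarrow> l f \<in> carrier P0" "\<And>f. f \<in> carrier P0 \<Longrightarrow> c f \<in> carrier P1"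
    and "\<And>\<eta>. \<eta> \<in> carrier P1 \<Longrightarrow> L \<eta> \<in> carrier P1"
    and c: "\<And>f. f \<in> carrier P0 \<Longrightarrow> \<theta> f = \<ominus>\<^bsub>P1\<^esub> c f"
    and fg: "f \<in> carrier P0" "g \<in> carrier P0"
  shows "\<xi> \<in> carrier P1 \<Longrightarrow>
      (Dd f (L \<xi>) \<ominus>\<^bsub>P1\<^esub> L (Dd f \<xi>)) \<oplus>\<^bsub>P1\<^esub> Dd (l f) \<xi> = br1 (\<theta> f) \<xi> \<longleftrightarrow>
      L (Dd f \<xi>) = Dd (l f) \<xi> \<oplus>\<^bsub>P1\<^esub> br1 (c f) \<xi> \<oplus>\<^bsub>P1\<^esub> Dd f (L \<xi>)"
    and "L (Kd f g) \<ominus>\<^bsub>P1\<^esub> Kd (l f) g \<ominus>\<^bsub>P1\<^esub> Kd f (l g) = \<ominus>\<^bsub>P1\<^esub> d_contravariant R P0 P1 br0 D \<theta> f g \<longleftrightarrow>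
      c (br0 f g) \<oplus>\<^bsub>P1\<^esub> L (Kd f g) =
        (Kd (l f) g \<ominus>\<^bsub>P1\<^esub> Dd g (c f)) \<oplus>\<^bsub>P1\<^esub> (Dd f (c g) \<oplus>\<^bsub>P1\<^esub> Kd f (l g))"
proof -
  have neg: "x = y \<longleftrightarrow> \<ominus>\<^bsub>P1\<^esub> x \<oplus>\<^bsub>P1\<^esub> y = \<zero>\<^bsub>P1\<^esub>" and pos: "x = y \<longleftrightarrow> x \<oplus>\<^bsub>P1\<^esub> \<ominus>\<^bsub>P1\<^esub> y = \<zero>\<^bsub>P1\<^esub>"
    if "x \<in> carrier P1" "y \<in> carrier P1" for x y
    using P1.L.M.eq_iff_diff_zero[of x y] P1.L.M.eq_iff_diff_zero[of y x] that
    by (auto simp: P1.L.M.minus_eq P1.L.M.a_comm)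
  note s = P1.L.M.minus_eq P1.L.M.minus_add P1.br_minus P1.L.M.a_ac
  show "(Dd f (L \<xi>) \<ominus>\<^bsub>P1\<^esub> L (Dd f \<xi>)) \<oplus>\<^bsub>P1\<^esub> Dd (l f) \<xi> = br1 (\<theta> f) \<xi> \<longleftrightarrow>
      L (Dd f \<xi>) = Dd (l f) \<xi> \<oplus>\<^bsub>P1\<^esub> br1 (c f) \<xi> \<oplus>\<^bsub>P1\<^esub> Dd f (L \<xi>)" if "\<xi> \<in> carrier P1"
    using assms that
    by (subst pos, simp, simp, subst neg[of "L (Dd f \<xi>)"], simp, simp, simp add: s)
  show "L (Kd f g) \<ominus>\<^bsub>P1\<^esub> Kd (l f) g \<ominus>\<^bsub>P1\<^esub> Kd f (l g) = \<ominus>\<^bsub>P1\<^esub> d_contravariant R P0 P1 br0 D \<theta> f g \<longleftrightarrow>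
      c (br0 f g) \<oplus>\<^bsub>P1\<^esub> L (Kd f g) =
        (Kd (l f) g \<ominus>\<^bsub>P1\<^esub> Dd g (c f)) \<oplus>\<^bsub>P1\<^esub> (Dd f (c g) \<oplus>\<^bsub>P1\<^esub> Kd f (l g))"
    using assms unfolding d_contravariant_def
    by (subst pos, simp, simp, subst pos[of "c (br0 f g) \<oplus>\<^bsub>P1\<^esub> L (Kd f g)"], simp, simp, simp add: s)
qed

lemma derivations_minus:
  assumes "\<theta> \<in> derivations R P0 P1"
  shows "(\<lambda>f\<in>carrier P0. \<ominus>\<^bsub>P1\<^esub> \<theta> f) \<in> derivations R P0 P1"
proof -
  note \<theta> = assms[unfolded derivations_iff]
  have "\<theta> f \<in> carrier P1" if "f \<in> carrier P0" for f using \<theta> that by auto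
  then show ?thesis
    using \<theta> unfolding derivations_iff
    by (auto simp: P1.L.M.minus_add P1.L.smult_r_minus)
qed

lemma frakM_iff: "L \<in> frakM R P0 P1 br0 br1 D K \<longleftrightarrow> (\<exists>l c. Poiss1_entries l c L)"
proof
  assume "L \<in> frakM R P0 P1 br0 br1 D K"
  then obtain l \<theta> where l: "l \<in> Poiss R P0 br0" and L: "generalized_derivation R P0 P1 l L"
    and L1: "\<forall>\<eta>\<in>carrier P1. \<forall>\<xi>\<in>carrier P1. L (br1 \<eta> \<xi>) = br1 (L \<eta>) \<xi> \<oplus>\<^bsub>P1\<^esub> br1 \<eta> (L \<xi>)"
    and \<theta>: "\<theta> \<in> derivations R P0 P1"
    and L2: "\<And>f \<xi>. f \<in> carrier P0 \<Longrightarrow> \<xi> \<in> carrier P1 \<Longrightarrow>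
      (Dd f (L \<xi>) \<ominus>\<^bsub>P1\<^esub> L (Dd f \<xi>)) \<oplus>\<^bsub>P1\<^esub> Dd (l f) \<xi> = br1 (\<theta> f) \<xi>"
    and L3: "\<And>f g. f \<in> carrier P0 \<Longrightarrow> g \<in> carrier P0 \<Longrightarrow>
      L (Kd f g) \<ominus>\<^bsub>P1\<^esub> Kd (l f) g \<ominus>\<^bsub>P1\<^esub> Kd f (l g) = \<ominus>\<^bsub>P1\<^esub> d_contravariant R P0 P1 br0 D \<theta> f g"
    unfolding frakM_def by blast
  define c where "c = (\<lambda>f\<in>carrier P0. \<ominus>\<^bsub>P1\<^esub> \<theta> f)"
  have \<theta>c: "\<theta> f \<in> carrier P1" if "f \<in> carrier P0" for f using \<theta> that by (auto simp: derivations_iff)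
  have cc: "c f \<in> carrier P1" "\<theta> f = \<ominus>\<^bsub>P1\<^esub> c f" if "f \<in> carrier P0" for f using \<theta>c that by (auto simp: c_def)
  have lc: "l f \<in> carrier P0" if "f \<in> carrier P0" for f
    using l that by (auto simp: Poiss_iff[OF P0.A.algebra_axioms])
  have Lc: "L \<eta> \<in> carrier P1" if "\<eta> \<in> carrier P1" for \<eta>
    using L that by (auto simp: generalized_derivation_def dest: module_homsD)
  note iffs = frakM_conditions_iff[OF lc cc(1) Lc cc(2)]
  have "Poiss1_entries l c L"
    unfolding Poiss1_entries_def
  proof (intro conjI ballI)
    show "c \<in> derivations R P0 P1" unfolding c_def by (rule derivations_minus[OF \<theta>])
    fix f assume f: "f \<in> carrier P0"
    show "L (Dd f \<xi>) = Dd (l f) \<xi> \<oplus>\<^bsub>P1\<^esub> br1 (c f) \<xi> \<oplus>\<^bsub>P1\<^esub> Dd f (L \<xi>)" if "\<xi> \<in> carrier P1" for \<xi>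
      by (subst iffs(1)[symmetric]) (use L2 f that in auto)
    show "c (br0 f g) \<oplus>\<^bsub>P1\<^esub> L (Kd f g) =
        (Kd (l f) g \<ominus>\<^bsub>P1\<^esub> Dd g (c f)) \<oplus>\<^bsub>P1\<^esub> (Dd f (c g) \<oplus>\<^bsub>P1\<^esub> Kd f (l g))" if "g \<in> carrier P0" for g
      by (subst iffs(2)[symmetric]) (use L3 f that in auto)
  qed (use l L L1 in auto)
  then show "\<exists>l c. Poiss1_entries l c L" by blast
next
  assume "\<exists>l c. Poiss1_entries l c L"
  then obtain l c where e: "Poiss1_entries l c L" by blast
  define \<theta> where "\<theta> = (\<lambda>f\<in>carrier P0. \<ominus>\<^bsub>P1\<^esub> c f)"
  note eD = Poiss1_entriesD[OF e] and e' = e[unfolded Poiss1_entries_def]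
  have c: "c \<in> derivations R P0 P1" using e' by blast
  have lc: "l f \<in> carrier P0" "c f \<in> carrier P1" "\<theta> f = \<ominus>\<^bsub>P1\<^esub> c f" if "f \<in> carrier P0" for f
    using eD that by (auto simp: \<theta>_def)
  have Lc: "L \<eta> \<in> carrier P1" if "\<eta> \<in> carrier P1" for \<eta> using eD that by auto
  note iffs = frakM_conditions_iff[OF lc(1,2) Lc lc(3)]
  show "L \<in> frakM R P0 P1 br0 br1 D K"
    unfolding frakM_def
  proof (intro CollectI bexI[of _ l] conjI bexI[of _ \<theta>] ballI)
    show "\<theta> \<in> derivations R P0 P1" unfolding \<theta>_def by (rule derivations_minus[OF c])
    fix f g assume fg: "f \<in> carrier P0" "g \<in> carrier P0"
    show "(Dd f (L \<eta>) \<ominus>\<^bsub>P1\<^esub> L (Dd f \<eta>)) \<oplus>\<^bsub>P1\<^esub> Dd (l f) \<eta> = br1 (\<theta> f) \<eta>" if "\<eta> \<in> carrier P1" for \<eta>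
      by (subst iffs(1)) (use e' fg that in auto)
    show "L (Kd f g) \<ominus>\<^bsub>P1\<^esub> Kd (l f) g \<ominus>\<^bsub>P1\<^esub> Kd f (l g) = \<ominus>\<^bsub>P1\<^esub> d_contravariant R P0 P1 br0 D \<theta> f g"
      by (subst iffs(2)) (use e' fg in auto)
  qed (use e' in auto)
qed

lemma frakM_eq_image: "frakM R P0 P1 br0 br1 D K = entry11 ` Poiss1 R P0 P1 br"
proof (intro subset_antisym subsetI)
  fix L assume "L \<in> frakM R P0 P1 br0 br1 D K"
  then obtain l c where "Poiss1_entries l c L" by (auto simp: frakM_iff)
  then show "L \<in> entry11 ` Poiss1 R P0 P1 br"
    using entries_map_Poiss1 entry11_entries_map by (intro image_eqI[of _ _ "entries_map l c L"]) simp_all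
next
  fix L assume "L \<in> entry11 ` Poiss1 R P0 P1 br"
  then show "L \<in> frakM R P0 P1 br0 br1 D K"
    unfolding frakM_iff using Poiss1_entries(1) by blast
qed

lemma entry11_linear:
  "(\<lambda>\<eta>\<in>carrier P1. entry11 X \<eta> \<oplus>\<^bsub>P1\<^esub> entry11 Y \<eta>) = entry11 (X \<oplus>\<^bsub>Poiss1_module\<^esub> Y)"
  "(\<lambda>\<eta>\<in>carrier P1. rs r (entry11 X \<eta>)) = entry11 (r \<odot>\<^bsub>Poiss1_module\<^esub> X)"
  "(\<lambda>\<eta>\<in>carrier P1. \<zero>\<^bsub>P1\<^esub>) = entry11 \<zero>\<^bsub>Poiss1_module\<^esub>"
  by (auto simp: entry11_def intro!: restrict_ext)

text \<open>Closure is transported from \<open>Poiss1_module\<close> along the linear map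
  \<open>entry11\<close>. This avoids combining the witnesses \<open>l\<close> and
  \<open>\<theta>\<close> hidden in the definition of \<open>frakM\<close>.\<close>

lemma module_frakM: "module R (frakM_module R P0 P1 br0 br1 D K)"
  unfolding frakM_module_def
proof (rule module_fun_module[OF RP1.module_axioms])
  interpret M: module R Poiss1_module by (rule module_Poiss1)
  let ?F = "frakM R P0 P1 br0 br1 D K"
  show "?F \<subseteq> carrier P1 \<rightarrow>\<^sub>E carrier RP1"
    using Poiss1_entriesD(3) by (intro subsetI) (auto simp only: frakM_iff restrict_scalars_simps)
  show "(\<lambda>x\<in>carrier P1. \<zero>\<^bsub>RP1\<^esub>) \<in> ?F"
    using M.M.zero_closed unfolding frakM_eq_image restrict_scalars_simps entry11_linear(3)
    by (intro imageI) (simp only: fun_module_simps(1))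
  show "(\<lambda>x\<in>carrier P1. f x \<oplus>\<^bsub>RP1\<^esub> g x) \<in> ?F" if fg: "f \<in> ?F" "g \<in> ?F" for f g
  proof -
    obtain X Y where "X \<in> Poiss1 R P0 P1 br" "Y \<in> Poiss1 R P0 P1 br" "f = entry11 X" "g = entry11 Y"
      using fg by (auto simp: frakM_eq_image)
    then show ?thesis
      using M.M.a_closed[of X Y] unfolding frakM_eq_image
      by (simp only: restrict_scalars_simps entry11_linear fun_module_simps(1)) blast
  qed
  show "(\<lambda>x\<in>carrier P1. r \<odot>\<^bsub>RP1\<^esub> f x) \<in> ?F" if rf: "r \<in> carrier R" "f \<in> ?F" for r f
  proof -
    obtain X where "X \<in> Poiss1 R P0 P1 br" "f = entry11 X"
      using rf by (auto simp: frakM_eq_image)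
    then show ?thesis
      using M.smult_closed[of r X] rf(1) unfolding frakM_eq_image
      by (simp only: restrict_scalars_simps entry11_linear fun_module_simps(1)) blast
  qed
qed

lemma entry11_hom:
  "(\<lambda>X\<in>Poiss1 R P0 P1 br. entry11 X) \<in> module_homs R Poiss1_module (frakM_module R P0 P1 br0 br1 D K)"
proof (rule module_homsI)
  interpret M: module R Poiss1_module by (rule module_Poiss1)
  fix X r assume X: "X \<in> carrier Poiss1_module"
  show "(\<lambda>X\<in>Poiss1 R P0 P1 br. entry11 X) X \<in> carrier (frakM_module R P0 P1 br0 br1 D K)"
    using X by (simp add: frakM_module_def frakM_eq_image)
  show "(\<lambda>X\<in>Poiss1 R P0 P1 br. entry11 X) (X \<oplus>\<^bsub>Poiss1_module\<^esub> Y) =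
      (\<lambda>X\<in>Poiss1 R P0 P1 br. entry11 X) X \<oplus>\<^bsub>frakM_module R P0 P1 br0 br1 D K\<^esub> (\<lambda>X\<in>Poiss1 R P0 P1 br. entry11 X) Y"
    if Y: "Y \<in> carrier Poiss1_module" for Y
    using X Y M.M.a_closed[OF X Y] entry11_linear(1)[of X Y] by (simp add: frakM_module_def)
  show "(\<lambda>X\<in>Poiss1 R P0 P1 br. entry11 X) (r \<odot>\<^bsub>Poiss1_module\<^esub> X) =
      r \<odot>\<^bsub>frakM_module R P0 P1 br0 br1 D K\<^esub> (\<lambda>X\<in>Poiss1 R P0 P1 br. entry11 X) X"
    if r: "r \<in> carrier R"
    using X M.smult_closed[OF r X] entry11_linear(2)[of r X] by (simp add: frakM_module_def)
qed simp

lemma entry11_ham: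
  assumes "h \<in> carrier P0" "\<zeta> \<in> carrier P1"
  shows "entry11 (P.ham (h, \<zeta>)) = (\<lambda>\<eta>\<in>carrier P1. Dd h \<eta> \<oplus>\<^bsub>P1\<^esub> br1 \<zeta> \<eta>)"
  using assms by (auto simp: entry11_def P.ham_def br_eq P1.L.M.minus_eq intro!: restrict_ext)

text \<open>A sum of an element of \<open>scrC\<close> given by \<open>h\<close> and one of
  \<open>Inn\<close> given by \<open>\<zeta>\<close> comes from the single Hamiltonian
  \<open>(h, \<zeta>)\<close>.\<close>

lemma entry11_Ham:
  "entry11 ` Ham P br = scrC R P0 P1 D <+>\<^bsub>frakM_module R P0 P1 br0 br1 D K\<^esub> Inn P1 br1"
proof -
  have "entry11 ` Ham P br = (\<Union>h\<in>carrier P0. \<Union>\<zeta>\<in>carrier P1. {\<lambda>\<eta>\<in>carrier P1. Dd h \<eta> \<oplus>\<^bsub>P1\<^esub> br1 \<zeta> \<eta>})"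
    by (force simp: P.Ham_eq image_image entry11_ham)
  also have "\<dots> = scrC R P0 P1 D <+>\<^bsub>frakM_module R P0 P1 br0 br1 D K\<^esub> Inn P1 br1"
    by (auto simp: set_add_def' scrC_def Inn_def frakM_module_def intro!: restrict_ext
        cong: restrict_cong)
  finally show ?thesis .
qed

section \<open>Cocycles and coboundaries as strictly lower triangular maps\<close>

abbreviation "cocycles1 \<equiv> cocycles R P0 P1 br0 br1 D 1"
abbreviation "cocycle_module \<equiv> fun_module (tuples P0 1) RP1 cocycles1"

text \<open>Literally the block map occurring in \<open>J_map\<close>, so that unfolding the latter
  folds back to it. \<open>J_rep_eq_entries_map\<close> passes to restricted entries, as the
  conditions on entries demand extensional maps.\<close>

definition J_rep :: "('a list \<Rightarrow> 'm) \<Rightarrow> 'a \<times> 'm \<Rightarrow> 'a \<times> 'm" where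
  "J_rep Q = block_map P0 P1 (\<lambda>f. \<zero>\<^bsub>P0\<^esub>) (\<lambda>\<eta>. \<zero>\<^bsub>P0\<^esub>) (\<lambda>f. Q [f]) (\<lambda>\<eta>. \<zero>\<^bsub>P1\<^esub>)"

lemma J_rep_apply: "f \<in> carrier P0 \<Longrightarrow> \<eta> \<in> carrier P1 \<Longrightarrow> J_rep Q (f, \<eta>) = (\<zero>\<^bsub>P0\<^esub>, Q [f] \<oplus>\<^bsub>P1\<^esub> \<zero>\<^bsub>P1\<^esub>)"
  by (simp add: J_rep_def block_map_def)

lemma J_rep_extensional [simp]: "J_rep Q \<in> extensional (carrier P0 \<times> carrier P1)"
  by (simp add: J_rep_def block_map_def)

lemma J_rep_eq_entries_map:
  "J_rep Q = entries_map (\<lambda>f\<in>carrier P0. \<zero>\<^bsub>P0\<^esub>) (\<lambda>f\<in>carrier P0. Q [f]) (\<lambda>\<eta>\<in>carrier P1. \<zero>\<^bsub>P1\<^esub>)"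
  by (rule extensionalityI[of _ "carrier P0 \<times> carrier P1"]) (auto simp: J_rep_apply entries_map_apply)

lemma zero_Poiss: "(\<lambda>f\<in>carrier P0. \<zero>\<^bsub>P0\<^esub>) \<in> Poiss R P0 br0"
  using abelian_monoid.zero_closed[of "fun_module (carrier P0) P0 (Poiss R P0 br0)"] P0.module_Poiss
  by (simp add: module_def abelian_group_def)

lemma zero_generalized_derivation:
  "generalized_derivation R P0 P1 (\<lambda>f\<in>carrier P0. \<zero>\<^bsub>P0\<^esub>) (\<lambda>\<eta>\<in>carrier P1. \<zero>\<^bsub>P1\<^esub>)"
  by (auto simp: generalized_derivation_def intro!: module_homsI)

text \<open>With zero diagonal, compatibility with \<open>Dd\<close> reduces to
  \<open>br1 (c f) \<xi> = \<zero>\<close>, so \<open>c\<close> is central-valued. In the last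
  condition all \<open>K\<close> terms vanish, and the cocycle equation is left.\<close>

lemma Poiss1_entries_zero_iff:
  "Poiss1_entries (\<lambda>f\<in>carrier P0. \<zero>\<^bsub>P0\<^esub>) c (\<lambda>\<eta>\<in>carrier P1. \<zero>\<^bsub>P1\<^esub>) \<longleftrightarrow>
    c \<in> derivations R P0 P1 \<and> (\<forall>f\<in>carrier P0. c f \<in> lie_center P1 br1) \<and>
    (\<forall>f\<in>carrier P0. \<forall>g\<in>carrier P0. Dd f (c g) \<ominus>\<^bsub>P1\<^esub> Dd g (c f) \<ominus>\<^bsub>P1\<^esub> c (br0 f g) = \<zero>\<^bsub>P1\<^esub>)"
proof (cases "c \<in> derivations R P0 P1")
  case True
  then have c: "c f \<in> carrier P1" if "f \<in> carrier P0" for f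
    using that by (auto simp: derivations_iff)
  have "x = (y \<oplus>\<^bsub>P1\<^esub> z) \<longleftrightarrow> z \<oplus>\<^bsub>P1\<^esub> y \<ominus>\<^bsub>P1\<^esub> x = \<zero>\<^bsub>P1\<^esub>"
    if "x \<in> carrier P1" "y \<in> carrier P1" "z \<in> carrier P1" for x y z
    using that P1.L.M.eq_iff_diff_zero[of "y \<oplus>\<^bsub>P1\<^esub> z" x] by (auto simp: P1.L.M.a_comm)
  then have "c (br0 f g) = \<ominus>\<^bsub>P1\<^esub> Dd g (c f) \<oplus>\<^bsub>P1\<^esub> Dd f (c g) \<longleftrightarrow>
      Dd f (c g) \<ominus>\<^bsub>P1\<^esub> Dd g (c f) \<ominus>\<^bsub>P1\<^esub> c (br0 f g) = \<zero>\<^bsub>P1\<^esub>"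
    if "f \<in> carrier P0" "g \<in> carrier P0" for f g
    using that c by (simp add: P1.L.M.minus_eq)
  then show ?thesis
    using True c unfolding Poiss1_entries_def
    by (auto simp: zero_Poiss zero_generalized_derivation lie_center_def P1.L.M.minus_eq eq_commute[of "\<zero>\<^bsub>P1\<^esub>"])
qed (simp add: Poiss1_entries_def)

lemma tuples_1: "tuples P0 (Suc 0) = (\<lambda>f. [f]) ` carrier P0"
  by (auto simp: tuples_def length_Suc_conv)

lemma tuples_0: "tuples P0 0 = {[]}"
  by (auto simp: tuples_def)

lemma tuples_2: "tuples P0 (Suc (Suc 0)) = (\<lambda>(f, g). [f, g]) ` (carrier P0 \<times> carrier P0)"
  by (auto simp: tuples_def length_Suc_conv image_iff)

lemma cochain_differential_1:
  assumes "f \<in> carrier P0" "g \<in> carrier P0" "\<And>f. f \<in> carrier P0 \<Longrightarrow> Q [f] \<in> carrier P1"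
  shows "cochain_differential R P0 P1 br0 D 1 Q [f, g] = Dd f (Q [g]) \<ominus>\<^bsub>P1\<^esub> Dd g (Q [f]) \<ominus>\<^bsub>P1\<^esub> Q [br0 f g]"
proof -
  have 1: "{..Suc 0} = {0, Suc 0}" by auto
  have 2: "{(i, j). i < j \<and> j \<le> Suc 0} = {(0, Suc 0)}" by auto
  have "[f, g] \<in> tuples P0 (Suc (Suc 0))" using assms by (auto simp: tuples_2)
  then show ?thesis
    using assms
    by (simp add: cochain_differential_def 1 2 alt_sign_def nths_Cons P1.L.M.minus_eq P1.L.M.finsum_insert)
qed

text \<open>This turns every question about 1-cocycles into one about \<open>Poiss1\<close>: module
  structure, coboundaries and exactness are all settled there.\<close>

lemma cocycles_iff:
  "Q \<in> cocycles1 \<longleftrightarrow> Q \<in> tuples P0 1 \<rightarrow>\<^sub>E carrier P1 \<and> J_rep Q \<in> Poiss1 R P0 P1 br"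
proof (cases "Q \<in> tuples P0 1 \<rightarrow>\<^sub>E carrier P1")
  case True
  then have Qc: "Q [f] \<in> carrier P1" if "f \<in> carrier P0" for f
    using that by (auto simp: tuples_1)
  define c where "c = (\<lambda>f\<in>carrier P0. Q [f])"
  \<comment> \<open>Replacing the entry of any one-element tuple by \<open>f\<close> gives
    \<open>[f]\<close>, so the derivation condition on cochains is the one on
    \<open>c\<close>.\<close>
  have "Q \<in> cochains R P0 P1 br1 1 \<longleftrightarrow> c \<in> derivations R P0 P1 \<and> (\<forall>f\<in>carrier P0. c f \<in> lie_center P1 br1)"
    using True by (auto simp: cochains_def tuples_1 PiE_iff c_def)
  moreover have "cochain_differential R P0 P1 br0 D 1 Q = \<zero>\<^bsub>cochain_module R P0 P1 br1 (Suc 1)\<^esub> \<longleftrightarrow>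
     (\<forall>f\<in>carrier P0. \<forall>g\<in>carrier P0. Dd f (c g) \<ominus>\<^bsub>P1\<^esub> Dd g (c f) \<ominus>\<^bsub>P1\<^esub> c (br0 f g) = \<zero>\<^bsub>P1\<^esub>)"
  proof -
    have "cochain_differential R P0 P1 br0 D 1 Q = \<zero>\<^bsub>cochain_module R P0 P1 br1 (Suc 1)\<^esub> \<longleftrightarrow>
      (\<forall>fs\<in>tuples P0 (Suc (Suc 0)). cochain_differential R P0 P1 br0 D 1 Q fs = \<zero>\<^bsub>P1\<^esub>)"
    proof
      assume "\<forall>fs\<in>tuples P0 (Suc (Suc 0)). cochain_differential R P0 P1 br0 D 1 Q fs = \<zero>\<^bsub>P1\<^esub>"
      then show "cochain_differential R P0 P1 br0 D 1 Q = \<zero>\<^bsub>cochain_module R P0 P1 br1 (Suc 1)\<^esub>"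
        by (intro extensionalityI[of _ "tuples P0 (Suc (Suc 0))"])
          (simp_all add: cochain_module_def, simp add: cochain_differential_def)
    qed (simp add: cochain_module_def)
    also have "\<dots> \<longleftrightarrow> (\<forall>f\<in>carrier P0. \<forall>g\<in>carrier P0. cochain_differential R P0 P1 br0 D 1 Q [f, g] = \<zero>\<^bsub>P1\<^esub>)"
      by (auto simp: tuples_2)
    also have "\<dots> \<longleftrightarrow> (\<forall>f\<in>carrier P0. \<forall>g\<in>carrier P0. Dd f (c g) \<ominus>\<^bsub>P1\<^esub> Dd g (c f) \<ominus>\<^bsub>P1\<^esub> c (br0 f g) = \<zero>\<^bsub>P1\<^esub>)"
    proof (intro ball_cong refl)
      fix f g assume "f \<in> carrier P0" "g \<in> carrier P0"
      then show "cochain_differential R P0 P1 br0 D 1 Q [f, g] = \<zero>\<^bsub>P1\<^esub> \<longleftrightarrow>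
          Dd f (c g) \<ominus>\<^bsub>P1\<^esub> Dd g (c f) \<ominus>\<^bsub>P1\<^esub> c (br0 f g) = \<zero>\<^bsub>P1\<^esub>"
        by (subst cochain_differential_1) (simp_all add: Qc c_def)
    qed
    finally show ?thesis .
  qed
  moreover have "J_rep Q \<in> Poiss1 R P0 P1 br \<longleftrightarrow>
      Poiss1_entries (\<lambda>f\<in>carrier P0. \<zero>\<^bsub>P0\<^esub>) c (\<lambda>\<eta>\<in>carrier P1. \<zero>\<^bsub>P1\<^esub>)"
    unfolding J_rep_eq_entries_map c_def
    by (rule entries_map_Poiss1_iff) (auto simp: Qc)
  ultimately show ?thesis
    using True by (simp only: cocycles_def mem_Collect_eq Poiss1_entries_zero_iff simp_thms conj_assoc)
next
  case False
  moreover have "lie_center P1 br1 \<subseteq> carrier P1" by (auto simp: lie_center_def)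
  ultimately show ?thesis
    by (auto simp: cocycles_def cochains_def PiE_iff)
qed

lemma J_rep_linear:
  assumes "Q \<in> tuples P0 1 \<rightarrow>\<^sub>E carrier P1"
  shows "Q' \<in> tuples P0 1 \<rightarrow>\<^sub>E carrier P1 \<Longrightarrow>
      J_rep (Q \<oplus>\<^bsub>cocycle_module\<^esub> Q') = J_rep Q \<oplus>\<^bsub>Poiss1_module\<^esub> J_rep Q'"
    and "r \<in> carrier R \<Longrightarrow> J_rep (r \<odot>\<^bsub>cocycle_module\<^esub> Q) = r \<odot>\<^bsub>Poiss1_module\<^esub> J_rep Q"
    and "J_rep \<zero>\<^bsub>cocycle_module\<^esub> = \<zero>\<^bsub>Poiss1_module\<^esub>"
proof -
  have Q: "Q [f] \<in> carrier P1" if "Q \<in> tuples P0 1 \<rightarrow>\<^sub>E carrier P1" "f \<in> carrier P0" for Q f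
    using that by (auto simp: tuples_1)
  note ext = extensionalityI[of _ "carrier P0 \<times> carrier P1"]
  show "J_rep (Q \<oplus>\<^bsub>cocycle_module\<^esub> Q') = J_rep Q \<oplus>\<^bsub>Poiss1_module\<^esub> J_rep Q'"
    if "Q' \<in> tuples P0 1 \<rightarrow>\<^sub>E carrier P1"
    using Q[OF assms] Q[OF that] by (intro ext) (auto simp: J_rep_apply tuples_1)
  show "J_rep (r \<odot>\<^bsub>cocycle_module\<^esub> Q) = r \<odot>\<^bsub>Poiss1_module\<^esub> J_rep Q" if "r \<in> carrier R"
    using Q[OF assms] that by (intro ext) (auto simp: J_rep_apply tuples_1)
  show "J_rep \<zero>\<^bsub>cocycle_module\<^esub> = \<zero>\<^bsub>Poiss1_module\<^esub>"
    by (intro ext) (auto simp: J_rep_apply tuples_1)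
qed

text \<open>\<open>J_rep\<close> is linear on all functions with values in \<open>P1\<close>, so
  closure of \<open>Poiss1\<close> pulls back through \<open>cocycles_iff\<close>.\<close>

lemma module_cocycles: "module R cocycle_module"
proof (rule module_fun_module[OF RP1.module_axioms])
  interpret M: module R Poiss1_module by (rule module_Poiss1)
  have z: "(\<lambda>x\<in>tuples P0 1. \<zero>\<^bsub>P1\<^esub>) \<in> tuples P0 1 \<rightarrow>\<^sub>E carrier P1" by auto
  have jz: "J_rep (\<lambda>x\<in>tuples P0 1. \<zero>\<^bsub>P1\<^esub>) = \<zero>\<^bsub>Poiss1_module\<^esub>"
    using J_rep_linear(3)[OF z] by (simp only: fun_module_simps restrict_scalars_simps)
  show "cocycles1 \<subseteq> tuples P0 1 \<rightarrow>\<^sub>E carrier RP1"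
    by (intro subsetI) (simp add: cocycles_iff del: One_nat_def)
  show "(\<lambda>x\<in>tuples P0 1. \<zero>\<^bsub>RP1\<^esub>) \<in> cocycles1"
    unfolding cocycles_iff restrict_scalars_simps jz
    using z M.M.zero_closed by (simp only: fun_module_simps(1) simp_thms)
  show "(\<lambda>x\<in>tuples P0 1. f x \<oplus>\<^bsub>RP1\<^esub> g x) \<in> cocycles1" if fg: "f \<in> cocycles1" "g \<in> cocycles1" for f g
  proof -
    have f: "f \<in> tuples P0 1 \<rightarrow>\<^sub>E carrier P1" "J_rep f \<in> carrier Poiss1_module"
      and g: "g \<in> tuples P0 1 \<rightarrow>\<^sub>E carrier P1" "J_rep g \<in> carrier Poiss1_module"
      using fg by (simp_all only: cocycles_iff fun_module_simps(1))
    have "(\<lambda>x\<in>tuples P0 1. f x \<oplus>\<^bsub>P1\<^esub> g x) \<in> tuples P0 1 \<rightarrow>\<^sub>E carrier P1"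
      using f(1) g(1) by (auto simp: PiE_mem simp del: One_nat_def)
    moreover have "J_rep (\<lambda>x\<in>tuples P0 1. f x \<oplus>\<^bsub>P1\<^esub> g x) \<in> Poiss1 R P0 P1 br"
      using J_rep_linear(1)[OF f(1) g(1)] M.M.a_closed[OF f(2) g(2)]
      by (simp only: fun_module_simps(1,3) restrict_scalars_simps)
    ultimately show ?thesis by (simp only: cocycles_iff restrict_scalars_simps simp_thms)
  qed
  show "(\<lambda>x\<in>tuples P0 1. r \<odot>\<^bsub>RP1\<^esub> f x) \<in> cocycles1" if rf: "r \<in> carrier R" "f \<in> cocycles1" for r f
  proof -
    have f: "f \<in> tuples P0 1 \<rightarrow>\<^sub>E carrier P1" "J_rep f \<in> carrier Poiss1_module"
      using rf by (simp_all only: cocycles_iff fun_module_simps(1))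
    have "(\<lambda>x\<in>tuples P0 1. rs r (f x)) \<in> tuples P0 1 \<rightarrow>\<^sub>E carrier P1"
      using f(1) rf(1) by (auto simp: PiE_mem simp del: One_nat_def)
    moreover have "J_rep (\<lambda>x\<in>tuples P0 1. rs r (f x)) \<in> Poiss1 R P0 P1 br"
      using J_rep_linear(2)[OF f(1) rf(1)] M.smult_closed[OF rf(1) f(2)]
      by (simp only: fun_module_simps(1,4) restrict_scalars_simps)
    ultimately show ?thesis by (simp only: cocycles_iff restrict_scalars_simps simp_thms)
  qed
qed

lemma J_rep_hom: "(\<lambda>Q\<in>cocycles1. J_rep Q) \<in> module_homs R cocycle_module Poiss1_module"
proof (rule module_homsI)
  interpret Z: module R cocycle_module by (rule module_cocycles)
  fix Q r assume Q: "Q \<in> carrier cocycle_module"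
  then have Q': "Q \<in> cocycles1" "Q \<in> tuples P0 1 \<rightarrow>\<^sub>E carrier P1"
    by (simp_all only: fun_module_simps(1) cocycles_iff)
  show "(\<lambda>Q\<in>cocycles1. J_rep Q) Q \<in> carrier Poiss1_module"
    using Q' by (simp add: cocycles_iff del: One_nat_def)
  show "(\<lambda>Q\<in>cocycles1. J_rep Q) (Q \<oplus>\<^bsub>cocycle_module\<^esub> S) =
      (\<lambda>Q\<in>cocycles1. J_rep Q) Q \<oplus>\<^bsub>Poiss1_module\<^esub> (\<lambda>Q\<in>cocycles1. J_rep Q) S"
    if S: "S \<in> carrier cocycle_module" for S
  proof -
    have "S \<in> cocycles1" "S \<in> tuples P0 1 \<rightarrow>\<^sub>E carrier P1"
      using S by (simp_all only: fun_module_simps(1) cocycles_iff)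
    moreover have "Q \<oplus>\<^bsub>cocycle_module\<^esub> S \<in> cocycles1"
      using Z.M.a_closed[OF Q S] by (simp only: fun_module_simps(1))
    ultimately show ?thesis using Q' J_rep_linear(1) by (simp only: restrict_apply' )
  qed
  show "(\<lambda>Q\<in>cocycles1. J_rep Q) (r \<odot>\<^bsub>cocycle_module\<^esub> Q) = r \<odot>\<^bsub>Poiss1_module\<^esub> (\<lambda>Q\<in>cocycles1. J_rep Q) Q"
    if r: "r \<in> carrier R"
  proof -
    have "r \<odot>\<^bsub>cocycle_module\<^esub> Q \<in> cocycles1"
      using Z.smult_closed[OF r Q] by (simp only: fun_module_simps(1))
    then show ?thesis using Q' r J_rep_linear(2) by (simp only: restrict_apply')
  qed
qed simp

text \<open>The differential of the 0-cochain with value \<open>\<zeta>\<close>; a 1-cochain takes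
  one-element lists, hence \<open>hd\<close>.\<close>

definition center_coboundary :: "'m \<Rightarrow> 'a list \<Rightarrow> 'm" where
  "center_coboundary \<zeta> = (\<lambda>fs\<in>tuples P0 1. Dd (hd fs) \<zeta>)"

lemma coboundaries_1: "coboundaries R P0 P1 br0 br1 D 1 = center_coboundary ` lie_center P1 br1"
proof -
  have diff: "cochain_differential R P0 P1 br0 D 0 Q = center_coboundary (Q [])"
    if "Q [] \<in> lie_center P1 br1" for Q
  proof (rule extensionalityI[of _ "tuples P0 1"])
    have "Q [] \<in> carrier P1" using that by (simp add: lie_center_def)
    \<comment> \<open>In degree zero the second sum of the differential runs over no pairs, and
      omitting the single entry in the first sum leaves the empty tuple.\<close>
    moreover have empty: "{(i, j). i < j \<and> j = (0::nat)} = {}" by auto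
    ultimately show "cochain_differential R P0 P1 br0 D 0 Q fs = center_coboundary (Q []) fs"
      if "fs \<in> tuples P0 1" for fs
      using that
      by (auto simp: center_coboundary_def cochain_differential_def tuples_1 alt_sign_def nths_Cons empty)
  qed (simp_all add: cochain_differential_def center_coboundary_def)
  have "cochain_differential R P0 P1 br0 D 0 ` ({[] :: 'a list} \<rightarrow>\<^sub>E lie_center P1 br1) =
      (\<lambda>Q. center_coboundary (Q [])) ` ({[] :: 'a list} \<rightarrow>\<^sub>E lie_center P1 br1)"
    by (intro image_cong refl diff) (auto simp: PiE_iff)
  moreover have "cochains R P0 P1 br1 0 = {[] :: 'a list} \<rightarrow>\<^sub>E lie_center P1 br1"
    by (auto simp: cochains_def tuples_0)
  ultimately have "coboundaries R P0 P1 br0 br1 D 1 = (\<lambda>Q. center_coboundary (Q [])) ` ({[] :: 'a list} \<rightarrow>\<^sub>E lie_center P1 br1)"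
    by (simp add: coboundaries_def)
  also have "\<dots> = center_coboundary ` ((\<lambda>Q. Q []) ` ({[] :: 'a list} \<rightarrow>\<^sub>E lie_center P1 br1))"
    by (simp only: image_image)
  also have "(\<lambda>Q. Q []) ` ({[] :: 'a list} \<rightarrow>\<^sub>E lie_center P1 br1) = lie_center P1 br1"
  proof (intro subset_antisym subsetI)
    fix \<zeta> assume "\<zeta> \<in> lie_center P1 br1"
    then show "\<zeta> \<in> (\<lambda>Q. Q []) ` ({[] :: 'a list} \<rightarrow>\<^sub>E lie_center P1 br1)"
      by (intro image_eqI[of _ _ "\<lambda>x\<in>{[]}. \<zeta>"]) simp_all
  qed (auto simp: PiE_iff)
  finally show ?thesis .
qed

text \<open>The bracket carries \<open>Dd g\<close> of its first \<open>P1\<close> argument with a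
  minus sign, hence the Hamiltonian \<open>- \<zeta>\<close>; centrality kills the
  \<open>br1\<close> term.\<close>

lemma J_rep_center_coboundary:
  assumes "\<zeta> \<in> lie_center P1 br1"
  shows "J_rep (center_coboundary \<zeta>) = P.ham (\<zero>\<^bsub>P0\<^esub>, \<ominus>\<^bsub>P1\<^esub> \<zeta>)"
proof (rule extensionalityI)
  have \<zeta>: "\<zeta> \<in> carrier P1" "\<And>\<eta>. \<eta> \<in> carrier P1 \<Longrightarrow> br1 \<zeta> \<eta> = \<zero>\<^bsub>P1\<^esub>"
    using assms by (auto simp: lie_center_def)
  fix x assume "x \<in> carrier P0 \<times> carrier P1"
  then show "J_rep (center_coboundary \<zeta>) x = P.ham (\<zero>\<^bsub>P0\<^esub>, \<ominus>\<^bsub>P1\<^esub> \<zeta>) x"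
    using \<zeta> by (auto simp: J_rep_apply center_coboundary_def tuples_1 P.ham_def br_eq P1.L.M.minus_eq P1.br_minus)
qed (simp_all add: P.ham_def)

text \<open>A coboundary is a cocycle because its \<open>J_rep\<close> is Hamiltonian, hence in
  \<open>Poiss1\<close>, so that \<open>cocycles_iff\<close> applies.\<close>

lemma submodule_coboundaries: "submodule (coboundaries R P0 P1 br0 br1 D 1) R cocycle_module"
proof -
  interpret Z: module R cocycle_module by (rule module_cocycles)
  have cc: "\<zeta> \<in> carrier P1" if "\<zeta> \<in> lie_center P1 br1" for \<zeta>
    using that by (simp add: lie_center_def)
  show ?thesis
    unfolding coboundaries_1
  proof (rule Z.submoduleI')
    show "center_coboundary ` lie_center P1 br1 \<subseteq> carrier cocycle_module"
    proof (intro subsetI, elim imageE)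
      fix Q \<zeta> assume \<zeta>: "\<zeta> \<in> lie_center P1 br1" and Q: "Q = center_coboundary \<zeta>"
      have "center_coboundary \<zeta> \<in> tuples P0 1 \<rightarrow>\<^sub>E carrier P1"
        using cc[OF \<zeta>] by (auto simp: center_coboundary_def tuples_1)
      moreover have "J_rep (center_coboundary \<zeta>) \<in> Poiss1 R P0 P1 br"
        using Ham_Poiss1 cc[OF \<zeta>] by (auto simp: J_rep_center_coboundary[OF \<zeta>] P.Ham_eq)
      ultimately show "Q \<in> carrier cocycle_module"
        by (simp only: Q fun_module_simps(1) cocycles_iff)
    qed
    have "\<zero>\<^bsub>cocycle_module\<^esub> = center_coboundary \<zero>\<^bsub>P1\<^esub>"
      by (auto simp: center_coboundary_def tuples_1 intro!: restrict_ext)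
    then show "\<zero>\<^bsub>cocycle_module\<^esub> \<in> center_coboundary ` lie_center P1 br1"
      by (intro image_eqI) (auto simp: lie_center_def)
  next
    fix Q S assume "Q \<in> center_coboundary ` lie_center P1 br1" "S \<in> center_coboundary ` lie_center P1 br1"
    then obtain \<zeta> \<xi> where z: "\<zeta> \<in> lie_center P1 br1" "\<xi> \<in> lie_center P1 br1"
      and QS: "Q = center_coboundary \<zeta>" "S = center_coboundary \<xi>" by blast
    have "Q \<oplus>\<^bsub>cocycle_module\<^esub> S = center_coboundary (\<zeta> \<oplus>\<^bsub>P1\<^esub> \<xi>)"
      using cc[OF z(1)] cc[OF z(2)] by (auto simp: QS center_coboundary_def tuples_1 intro!: restrict_ext)
    moreover have "\<zeta> \<oplus>\<^bsub>P1\<^esub> \<xi> \<in> lie_center P1 br1"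
      using z by (simp add: lie_center_def P1.br_linear)
    ultimately show "Q \<oplus>\<^bsub>cocycle_module\<^esub> S \<in> center_coboundary ` lie_center P1 br1"
      by (rule image_eqI)
  next
    fix r Q assume r: "r \<in> carrier R" and "Q \<in> center_coboundary ` lie_center P1 br1"
    then obtain \<zeta> where z: "\<zeta> \<in> lie_center P1 br1" and Q: "Q = center_coboundary \<zeta>" by blast
    have "r \<odot>\<^bsub>cocycle_module\<^esub> Q = center_coboundary (rs r \<zeta>)"
      using cc[OF z] r by (auto simp: Q center_coboundary_def tuples_1 intro!: restrict_ext)
    moreover have "rs r \<zeta> \<in> lie_center P1 br1"
      using z r by (simp add: lie_center_def P1.br_linear)
    ultimately show "r \<odot>\<^bsub>cocycle_module\<^esub> Q \<in> center_coboundary ` lie_center P1 br1"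
      by (rule image_eqI)
  qed
qed

section \<open>Exactness up to Hamiltonian derivations and assembly of the sequence\<close>

text \<open>At \<open>(\<zero>, \<eta>)\<close> the second component of \<open>J_rep Q\<close> is
  \<open>Q [\<zero>] \<oplus> \<zero>\<close>, so the point is \<open>Q [\<zero>] = \<zero>\<close>;
  this holds because a cocycle is additive.\<close>

lemma entry11_J_rep:
  assumes "Q \<in> cocycles1"
  shows "entry11 (J_rep Q) = (\<lambda>\<eta>\<in>carrier P1. \<zero>\<^bsub>P1\<^esub>)"
proof -
  have Q: "Q \<in> tuples P0 1 \<rightarrow>\<^sub>E carrier P1" "J_rep Q \<in> Poiss1 R P0 P1 br"
    using assms by (simp_all only: cocycles_iff)
  have "Poiss1_entries (\<lambda>f\<in>carrier P0. \<zero>\<^bsub>P0\<^esub>) (\<lambda>f\<in>carrier P0. Q [f]) (\<lambda>\<eta>\<in>carrier P1. \<zero>\<^bsub>P1\<^esub>)"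
    using Q unfolding J_rep_eq_entries_map
    by (subst (asm) entries_map_Poiss1_iff) (auto simp: tuples_1)
  then show ?thesis unfolding J_rep_eq_entries_map by (rule entry11_entries_map)
qed

text \<open>Faithfulness enters here: \<open>X\<^sub>1\<^sub>1 = 0\<close> forces \<open>X\<^sub>0\<^sub>0 = 0\<close>.\<close>

lemma entry11_zero:
  assumes "X \<in> Poiss1 R P0 P1 br" "entry11 X = (\<lambda>\<eta>\<in>carrier P1. \<zero>\<^bsub>P1\<^esub>)"
  obtains Q where "Q \<in> cocycles1" "X = J_rep Q"
proof -
  define Q where "Q = (\<lambda>fs\<in>tuples P0 1. entry10 X (hd fs))"
  note e = Poiss1_entries(1)[OF assms(1)]
  have c: "entry10 X f \<in> carrier P1" and l: "entry00 X f \<in> carrier P0" if "f \<in> carrier P0" for f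
    using Poiss1_entriesD(1,2)[OF e] that by auto
  have "entry00 X f = \<zero>\<^bsub>P0\<^esub>" if f: "f \<in> carrier P0" for f
  proof (rule faithful)
    fix \<eta> assume "\<eta> \<in> carrier P1"
    \<comment> \<open>With both \<open>entry11\<close> terms zero, the Leibniz rule of the
      generalized derivation leaves only \<open>entry00 X f \<odot> \<eta>\<close>.\<close>
    moreover from this have "entry11 X (f \<odot>\<^bsub>P1\<^esub> \<eta>) = f \<odot>\<^bsub>P1\<^esub> entry11 X \<eta> \<oplus>\<^bsub>P1\<^esub> entry00 X f \<odot>\<^bsub>P1\<^esub> \<eta>"
      using e f by (simp add: Poiss1_entries_def generalized_derivation_def)
    ultimately show "entry00 X f \<odot>\<^bsub>P1\<^esub> \<eta> = \<zero>\<^bsub>P1\<^esub>"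
      using f l[OF f] by (simp add: assms(2))
  qed (rule l[OF f])
  then have "entry00 X = (\<lambda>f\<in>carrier P0. \<zero>\<^bsub>P0\<^esub>)"
    using Poiss1_entriesD(1)[OF e] by (intro extensionalityI[of _ "carrier P0"]) (auto simp: PiE_iff)
  moreover have "entry10 X = (\<lambda>f\<in>carrier P0. Q [f])"
    using Poiss1_entriesD(2)[OF e]
    by (intro extensionalityI[of _ "carrier P0"]) (auto simp: PiE_iff Q_def tuples_1)
  ultimately have X: "X = J_rep Q"
    unfolding J_rep_eq_entries_map by (metis Poiss1_entries(2)[OF assms(1)] assms(2))
  have "Q \<in> tuples P0 1 \<rightarrow>\<^sub>E carrier P1"
    using c by (auto simp: Q_def tuples_1)
  then have "Q \<in> cocycles1"
    using assms(1) X by (simp only: cocycles_iff)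
  then show thesis using X that by blast
qed

text \<open>Subtracting a Hamiltonian derivation with the same \<open>entry11\<close> leaves an
  element of the kernel of \<open>entry11\<close>, which \<open>entry11_zero\<close> identifies as
  some \<open>J_rep Q\<close>. Conversely, adding \<open>J_rep Q\<close> does not change
  \<open>entry11\<close>.\<close>

lemma entry11_exact:
  assumes X: "X \<in> Poiss1 R P0 P1 br"
  shows "entry11 X \<in> entry11 ` Ham P br \<longleftrightarrow> (\<exists>Q\<in>cocycles1. \<exists>Y\<in>Ham P br. X = Y \<oplus>\<^bsub>Poiss1_module\<^esub> J_rep Q)"
proof -
  interpret M: module R Poiss1_module by (rule module_Poiss1)
  interpret N: module R "frakM_module R P0 P1 br0 br1 D K" by (rule module_frakM)
  have add: "entry11 (Y \<oplus>\<^bsub>Poiss1_module\<^esub> Z) = entry11 Y \<oplus>\<^bsub>frakM_module R P0 P1 br0 br1 D K\<^esub> entry11 Z"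
    for Y Z
    using entry11_linear(1)[of Y Z] by (simp add: frakM_module_def)
  have mem: "entry11 Y \<in> carrier (frakM_module R P0 P1 br0 br1 D K)" if "Y \<in> carrier Poiss1_module" for Y
    using that by (simp add: frakM_module_def frakM_eq_image)
  have zero: "\<zero>\<^bsub>frakM_module R P0 P1 br0 br1 D K\<^esub> = (\<lambda>\<eta>\<in>carrier P1. \<zero>\<^bsub>P1\<^esub>)"
    by (simp add: frakM_module_def)
  have X': "X \<in> carrier Poiss1_module" using X by simp
  have H: "Y \<in> carrier Poiss1_module" if "Y \<in> Ham P br" for Y using Ham_Poiss1 that by auto
  show ?thesis
  proof
    assume "entry11 X \<in> entry11 ` Ham P br"
    then obtain Y where Y: "Y \<in> Ham P br" "entry11 X = entry11 Y" by blast
    define Z where "Z = X \<oplus>\<^bsub>Poiss1_module\<^esub> \<ominus>\<^bsub>Poiss1_module\<^esub> Y"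
    have Z: "Z \<in> carrier Poiss1_module" unfolding Z_def using X' H[OF Y(1)] by (intro M.M.a_closed M.M.a_inv_closed)
    have XYZ: "X = Y \<oplus>\<^bsub>Poiss1_module\<^esub> Z"
      unfolding Z_def M.M.a_lcomm[OF H[OF Y(1)] X' M.M.a_inv_closed[OF H[OF Y(1)]]]
      by (simp only: M.M.r_neg[OF H[OF Y(1)]] M.M.r_zero[OF X'])
    have "entry11 Y \<oplus>\<^bsub>frakM_module R P0 P1 br0 br1 D K\<^esub> entry11 Z = entry11 Y"
      by (simp only: add[symmetric] XYZ[symmetric] Y(2))
    then have "entry11 Z = (\<lambda>\<eta>\<in>carrier P1. \<zero>\<^bsub>P1\<^esub>)"
      using N.M.add.l_cancel_one[OF mem[OF H[OF Y(1)]] mem[OF Z]] by (simp only: zero)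
    then obtain Q where "Q \<in> cocycles1" "Z = J_rep Q"
      using entry11_zero[of Z] Z unfolding fun_module_simps(1) by blast
    then show "\<exists>Q\<in>cocycles1. \<exists>Y\<in>Ham P br. X = Y \<oplus>\<^bsub>Poiss1_module\<^esub> J_rep Q"
      using XYZ Y(1) by blast
  next
    assume "\<exists>Q\<in>cocycles1. \<exists>Y\<in>Ham P br. X = Y \<oplus>\<^bsub>Poiss1_module\<^esub> J_rep Q"
    then obtain Q Y where Q: "Q \<in> cocycles1" and Y: "Y \<in> Ham P br"
      and "X = Y \<oplus>\<^bsub>Poiss1_module\<^esub> J_rep Q" by blast
    then have "entry11 X = entry11 Y"
      using mem[OF H[OF Y]] by (simp only: add entry11_J_rep[OF Q] zero[symmetric] N.M.r_zero)
    then show "entry11 X \<in> entry11 ` Ham P br" using Y by blast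
  qed
qed

text \<open>Well-definedness of \<open>J\<close>: two representatives differ by a coboundary, whose
  \<open>J_rep\<close> is Hamiltonian, so the union in \<open>J_map\<close> runs over one repeated
  coset.\<close>

lemma J_map_coset:
  assumes "Q \<in> cocycles1"
  shows "J_map R P0 P1 br (coboundaries R P0 P1 br0 br1 D 1 +>\<^bsub>cocycle_module\<^esub> Q) =
    Ham P br +>\<^bsub>Poiss1_module\<^esub> J_rep Q"
proof -
  interpret H: quotient_module R Poiss1_module "Ham P br"
    using module_Poiss1 submodule_Ham by (rule quotient_module.intro)
  interpret B: quotient_module R cocycle_module "coboundaries R P0 P1 br0 br1 D 1"
    using module_cocycles submodule_coboundaries by (rule quotient_module.intro)
  let ?C = "coboundaries R P0 P1 br0 br1 D 1 +>\<^bsub>cocycle_module\<^esub> Q"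
  have Q: "Q \<in> tuples P0 1 \<rightarrow>\<^sub>E carrier P1" "J_rep Q \<in> carrier Poiss1_module"
    using assms by (simp_all only: cocycles_iff fun_module_simps(1))
  have "Ham P br +>\<^bsub>Poiss1_module\<^esub> J_rep S = Ham P br +>\<^bsub>Poiss1_module\<^esub> J_rep Q" if S: "S \<in> ?C" for S
  proof -
    obtain T where T: "T \<in> coboundaries R P0 P1 br0 br1 D 1" and ST: "S = T \<oplus>\<^bsub>cocycle_module\<^esub> Q"
      using S by (auto simp only: B.mem_coset_iff)
    obtain \<zeta> where \<zeta>: "\<zeta> \<in> lie_center P1 br1" "T = center_coboundary \<zeta>"
      using T by (auto simp only: coboundaries_1)
    have "T \<in> cocycles1" using T B.a_subset by auto
    then have "J_rep S = J_rep T \<oplus>\<^bsub>Poiss1_module\<^esub> J_rep Q"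
      unfolding ST using Q(1) by (intro J_rep_linear(1)) (simp_all only: cocycles_iff)
    moreover have "J_rep T \<in> Ham P br"
      using \<zeta> by (auto simp: J_rep_center_coboundary P.Ham_eq lie_center_def)
    ultimately have "J_rep S \<in> Ham P br +>\<^bsub>Poiss1_module\<^esub> J_rep Q"
      by (auto simp only: H.mem_coset_iff)
    then show ?thesis using H.a_repr_independence' Q(2) by blast
  qed
  then have "(\<Union>S\<in>?C. Ham P br +>\<^bsub>Poiss1_module\<^esub> J_rep S) = (\<Union>S\<in>?C. Ham P br +>\<^bsub>Poiss1_module\<^esub> J_rep Q)"
    by (rule SUP_cong[OF refl])
  also have "\<dots> = Ham P br +>\<^bsub>Poiss1_module\<^esub> J_rep Q"
    using B.a_rcos_self[of Q] assms by (simp only: UN_constant fun_module_simps(1)) (metis empty_iff)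
  finally show ?thesis
    \<comment> \<open>\<open>J_map\<close> forms its coset in the module on \<open>Poiss\<close>,
      the statement in the one on \<open>Poiss1\<close>. A coset depends only on the addition, which
      the two share.\<close>
    by (simp only: J_map_def Let_def J_rep_def[symmetric] a_r_coset_def' fun_module_simps(3))
qed

lemma exact_sequence:
  "\<exists>\<phi> \<psi>. short_exact_sequence R
    (quot_module (cohomology R P0 P1 br0 br1 D 1)
      (a_kernel (cohomology R P0 P1 br0 br1 D 1) (poisson_H1 R P br) (J_map R P0 P1 br)))
    (poisson_H1_rest R P0 P1 br)
    (quot_module (frakM_module R P0 P1 br0 br1 D K)
      (scrC R P0 P1 D <+>\<^bsub>frakM_module R P0 P1 br0 br1 D K\<^esub> Inn P1 br1))
    \<phi> \<psi>"
proof -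
  have coh: "cohomology R P0 P1 br0 br1 D 1 = quot_module cocycle_module (coboundaries R P0 P1 br0 br1 D 1)"
    by (simp add: cohomology_def cochain_module_def fun_module_def)
  let ?p = "\<lambda>X\<in>Poiss1 R P0 P1 br. entry11 X" and ?j = "\<lambda>Q\<in>cocycles1. J_rep Q"
  have p_Ham: "?p ` Ham P br = entry11 ` Ham P br"
    using Ham_Poiss1 by (intro image_cong) auto
  have "\<exists>\<phi> \<psi>. short_exact_sequence R
    (quot_module (quot_module cocycle_module (coboundaries R P0 P1 br0 br1 D 1))
      (a_kernel (quot_module cocycle_module (coboundaries R P0 P1 br0 br1 D 1)) (poisson_H1 R P br) (J_map R P0 P1 br)))
    (quot_module Poiss1_module (Ham P br))
    (quot_module (frakM_module R P0 P1 br0 br1 D K) (?p ` Ham P br)) \<phi> \<psi>"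
  proof (rule short_exact_sequence_quotients[OF module_cocycles module_Poiss1 module_frakM J_rep_hom entry11_hom
        _ submodule_coboundaries submodule_Ham])
    show "?p ` carrier Poiss1_module = carrier (frakM_module R P0 P1 br0 br1 D K)"
      by (simp add: frakM_module_def frakM_eq_image)
    show "?j ` coboundaries R P0 P1 br0 br1 D 1 \<subseteq> Ham P br"
    proof (intro image_subsetI)
      fix T assume T: "T \<in> coboundaries R P0 P1 br0 br1 D 1"
      then have "T \<in> cocycles1"
        using module.submoduleE(1)[OF module_cocycles submodule_coboundaries] by auto
      then show "?j T \<in> Ham P br"
        using T unfolding coboundaries_1
        by (auto simp: J_rep_center_coboundary P.Ham_eq lie_center_def)
    qed
    show "?p X \<in> ?p ` Ham P br \<longleftrightarrow> (\<exists>Q\<in>carrier cocycle_module. \<exists>Y\<in>Ham P br. X = Y \<oplus>\<^bsub>Poiss1_module\<^esub> ?j Q)"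
      if "X \<in> carrier Poiss1_module" for X
      using that entry11_exact[of X] unfolding p_Ham
      by (simp only: fun_module_simps(1) restrict_apply' cong: bex_cong)
    show "J_map R P0 P1 br (coboundaries R P0 P1 br0 br1 D 1 +>\<^bsub>cocycle_module\<^esub> Q) =
        Ham P br +>\<^bsub>Poiss1_module\<^esub> ?j Q" if "Q \<in> carrier cocycle_module" for Q
      using that J_map_coset[of Q] by (simp only: fun_module_simps(1) restrict_apply')
  \<comment> \<open>What remains is that the zero of \<open>poisson_H1\<close> is
    \<open>Ham\<close>, as it is for \<open>poisson_H1_rest\<close>.\<close>
  qed (simp add: poisson_H1_def)
  then show ?thesis
    by (simp only: coh p_Ham entry11_Ham poisson_H1_rest_def)
qed

end

theorem theorem8p7:
  fixes R :: "'r ring"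
    and P0 :: "('r, 'a) module"
    and P1 :: "('a, 'm) module"
    and br0 :: "'a \<Rightarrow> 'a \<Rightarrow> 'a"
    and br :: "'a \<times> 'm \<Rightarrow> 'a \<times> 'm \<Rightarrow> 'a \<times> 'm"
    and br1 :: "'m \<Rightarrow> 'm \<Rightarrow> 'm"
    and D :: "('a \<Rightarrow> 'a) set \<Rightarrow> 'm \<Rightarrow> 'm"
    and K :: "('a \<Rightarrow> 'a) set \<Rightarrow> ('a \<Rightarrow> 'a) set \<Rightarrow> 'm"
  assumes "admissible_poisson_algebra R P0 P1 br0 br"
    and "corresponding_poisson_triple R P0 P1 br0 br br1 D K"
  shows "\<exists>\<phi> \<psi>. short_exact_sequence R
    (quot_module (cohomology R P0 P1 br0 br1 D 1)
      (a_kernel (cohomology R P0 P1 br0 br1 D 1) (poisson_H1 R (semidirect P0 P1) br)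
        (J_map R P0 P1 br)))
    (poisson_H1_rest R P0 P1 br)
    (quot_module (frakM_module R P0 P1 br0 br1 D K)
      (scrC R P0 P1 D <+>\<^bsub>frakM_module R P0 P1 br0 br1 D K\<^esub> Inn P1 br1))
    \<phi> \<psi>"
proof -
  interpret poisson_triple R P0 P1 br0 br br1 D K
    using assms by (rule poisson_triple.intro)
  show ?thesis by (rule exact_sequence)
qed

end
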